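(* For $0<\nu<\infty$ let $X_\nu=(X_\nu(t))_{t\in\mathbb{R}}$ be a centered stationary Gaussian process with continuous sample paths and spectral measure $F_\nu(du)=e^{-|u|^\nu}\,du$ on $\mathbb{R}$, and let $X_\infty$ be a centered stationary Gaussian process with continuous sample paths and spectral measure $F_\infty(du)=\mathbf{1}_{[-1,1]}(u)\,du$. Let $$\varphi(X_\nu,r)=-\log \mathbb{P}\Big(\sup_{t\in[0,1]}|X_\nu(t)|\le r\Big),\qquad r>0.$$ Then, as $r\to 0$, $$\varphi(X_\nu,r)\approx \frac{|\log r|^2}{\log|\log r|}\qquad\text{for every } 1<\nu\le\infty,$$ and $$\varphi(X_\nu,r)\approx |\log r|^{1+\frac1\nu}\qquad\text{for every } 0<\nu\le 1.$$
   Context: The process is real-valued. A centered stationary Gaussian process $X$ has (symmetric, finite) spectral measure $F$ if $\mathbb{E}\,X(s)X(t)=\int_{\mathbb{R}}e^{i(s-t)u}\,F(du)$ for all $s,t\in\mathbb{R}$. For functions of $r\to 0$ (positive for small $r$), $f\preceq g$ means $\limsup_{r\to0} f(r)/g(r)<\infty$, and $f\approx g$ means that both $f\preceq g$ and $g\preceq f$ hold. *)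

theory Defs
  imports "HOL-Probability.Probability"
begin

text \<open>Point masses count as (degenerate) Gaussian laws, as is needed for linear combinations.\<close>

definition gaussian_law :: "real measure \<Rightarrow> bool" where
  "gaussian_law L \<longleftrightarrow>
     (\<exists>m. L = return borel m) \<or>
     (\<exists>m \<sigma>. 0 < \<sigma> \<and> L = density lborel (\<lambda>x. ennreal (normal_density m \<sigma> x)))"

definition gaussian_process :: "'a measure \<Rightarrow> (real \<Rightarrow> 'a \<Rightarrow> real) \<Rightarrow> bool" where
  "gaussian_process M X \<longleftrightarrow>
     prob_space M \<and>
     (\<forall>t. X t \<in> borel_measurable M) \<and>
     (\<forall>J c. finite J \<longrightarrow> gaussian_law (distr M borel (\<lambda>\<omega>. \<Sum>t\<in>J. c t * X t \<omega>)))"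

definition centered_process :: "'a measure \<Rightarrow> (real \<Rightarrow> 'a \<Rightarrow> real) \<Rightarrow> bool" where
  "centered_process M X \<longleftrightarrow> (\<forall>t. (\<integral>\<omega>. X t \<omega> \<partial>M) = 0)"

definition stationary_process :: "'a measure \<Rightarrow> (real \<Rightarrow> 'a \<Rightarrow> real) \<Rightarrow> bool" where
  "stationary_process M X \<longleftrightarrow>
     (\<forall>h J. finite J \<longrightarrow>
        distr M (Pi\<^sub>M J (\<lambda>_. borel)) (\<lambda>\<omega>. \<lambda>t\<in>J. X (t + h) \<omega>) =
        distr M (Pi\<^sub>M J (\<lambda>_. borel)) (\<lambda>\<omega>. \<lambda>t\<in>J. X t \<omega>))"

definition continuous_paths :: "'a measure \<Rightarrow> (real \<Rightarrow> 'a \<Rightarrow> real) \<Rightarrow> bool" where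
  "continuous_paths M X \<longleftrightarrow> (\<forall>\<omega>\<in>space M. continuous_on UNIV (\<lambda>t. X t \<omega>))"

definition has_spectral_measure ::
    "'a measure \<Rightarrow> (real \<Rightarrow> 'a \<Rightarrow> real) \<Rightarrow> real measure \<Rightarrow> bool" where
  "has_spectral_measure M X F \<longleftrightarrow>
     sets F = sets borel \<and> finite_measure F \<and> distr F borel uminus = F \<and>
     (\<forall>s t. complex_of_real (\<integral>\<omega>. X s \<omega> * X t \<omega> \<partial>M) =
            (\<integral>u. exp (\<i> * complex_of_real ((s - t) * u)) \<partial>F))"

definition spectral_family :: "ereal \<Rightarrow> real measure" where
  "spectral_family \<nu> =
     density lborel
       (\<lambda>u. ennreal (if \<nu> = \<infinity> then indicator {-1..1} u
                     else exp (- (\<bar>u\<bar> powr real_of_ereal \<nu>))))"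

definition small_ball :: "'a measure \<Rightarrow> (real \<Rightarrow> 'a \<Rightarrow> real) \<Rightarrow> real \<Rightarrow> real" where
  "small_ball M X r = - ln (measure M {\<omega> \<in> space M. (SUP t\<in>{0..1}. \<bar>X t \<omega>\<bar>) \<le> r})"

text \<open>
  The relation is meant for functions that are positive for small \<open>r\<close>; positivity is part of the
  definition. This also excludes artefacts of \<open>x / 0 = 0\<close> and \<open>ln 0 = 0\<close>: a vanishing small ball
  probability would give the value 0 of \<open>small_ball\<close>, which is not positive.
\<close>

definition asymp_le :: "(real \<Rightarrow> real) \<Rightarrow> (real \<Rightarrow> real) \<Rightarrow> bool" where
  "asymp_le f g \<longleftrightarrow>
     (\<forall>\<^sub>F r in at_right 0. 0 < f r \<and> 0 < g r) \<and>
     Limsup (at_right 0) (\<lambda>r. ereal (f r / g r)) < \<infinity>"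

definition asymp_equiv_order :: "(real \<Rightarrow> real) \<Rightarrow> (real \<Rightarrow> real) \<Rightarrow> bool" where
  "asymp_equiv_order f g \<longleftrightarrow> asymp_le f g \<and> asymp_le g f"

end

theory Submission
  imports Defs "HOL-Real_Asymp.Real_Asymp"
begin

text \<open>
  Everything rests on a Fourier duality: if \<open>g\<close> is a standard Gaussian vector independent of the
  centered Gaussian vector \<open>(Y\<^sub>i)\<close>, then
  \<open>E exp (- (\<Sum>i. Y\<^sub>i\<^sup>2) / 2) = E exp (- Var (\<Sum>i. g\<^sub>i Y\<^sub>i | g) / 2)\<close>. Hence two-sided bounds on the variance form
  \<open>V g = \<integral>u. f u * \<bar>\<Sum>i. g\<^sub>i exp (\<i> t\<^sub>i u)\<bar>\<^sup>2\<close> give two-sided bounds on the probability that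
  \<open>X\<close> is small on a finite set of times; neither independence of the coordinates nor a correlation
  inequality is needed.

  For upper bounds on the probability take \<open>t\<^sub>j = j / n\<close> with \<open>j < n\<close>. Orthogonality of \<open>exp (\<i> j u / n)\<close>
  on \<open>[-\<pi> n, \<pi> n]\<close> gives \<open>V g \<ge> exp (- (\<pi> n) powr \<nu>) * \<bar>g\<bar>\<^sup>2\<close>, used with \<open>n \<approx> L powr (1 / \<nu>)\<close> where
  \<open>L = - ln r\<close>. For \<open>\<nu> > 1\<close> only the density on \<open>[-1, 1]\<close> matters: first-order difference operators
  isolate one coefficient of an exponential sum and give \<open>V g \<ge> n powr (- C n) * \<bar>g\<bar>\<^sup>2\<close>, used with
  \<open>n \<approx> L / ln L\<close>.

  For lower bounds, Taylor expansion of \<open>exp (\<i> t u)\<close> of degree less than \<open>m\<close> on intervals of length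
  \<open>1 / Q\<close> bounds \<open>V\<close> by a form of rank \<open>n = (Q + 1) m\<close> plus a tiny multiple of \<open>\<bar>g\<bar>\<^sup>2\<close>, whence the
  probability on a grid of mesh about \<open>r\<^sup>2\<close> is at least \<open>exp (- C n L)\<close>. Dyadic chaining passes from the
  grid to the supremum. The optimal choices are \<open>Q = 1\<close>, \<open>m \<approx> L / ln L\<close> for \<open>\<nu> > 1\<close> and
  \<open>Q \<approx> m powr (1 / \<nu> - 1)\<close>, \<open>m \<approx> L\<close> for \<open>\<nu> \<le> 1\<close>.
\<close>

section \<open>Centered Gaussian laws and Fourier duality\<close>

abbreviation "std_gauss \<equiv> std_normal_distribution"

lemma gaussian_law_centered_cases:
  assumes "gaussian_law L" "(\<integral>x. x \<partial>L) = 0"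
  obtains "L = return borel 0"
  | \<sigma> where "0 < \<sigma>" "L = density lborel (\<lambda>x. ennreal (normal_density 0 \<sigma> x))"
proof -
  have "m = 0" if "L = return borel m" for m
    using assms(2) that by (simp add: integral_return)
  moreover have "m = 0" if "0 < \<sigma>" "L = density lborel (\<lambda>x. ennreal (normal_density m \<sigma> x))" for m \<sigma>
  proof -
    have "(\<integral>x. x \<partial>L) = (\<integral>x. normal_density m \<sigma> x * x \<partial>lborel)"
      unfolding that(2) by (subst integral_real_density) auto
    then show ?thesis using integral_normal_moment_nz_1[OF that(1), of m] assms(2) by simp
  qed
  ultimately show thesis
    using assms(1) that unfolding gaussian_law_def by metis
qed

lemma normal_second_moment:
  assumes "0 < \<sigma>"
  shows "integrable (density lborel (\<lambda>x. ennreal (normal_density 0 \<sigma> x))) (\<lambda>x. x\<^sup>2)"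
    and "(\<integral>x. x\<^sup>2 \<partial>density lborel (\<lambda>x. ennreal (normal_density 0 \<sigma> x))) = \<sigma>\<^sup>2"
proof -
  show "integrable (density lborel (\<lambda>x. ennreal (normal_density 0 \<sigma> x))) (\<lambda>x. x\<^sup>2)"
    using integrable_normal_moment[OF assms, of 0 2] by (subst integrable_real_density) auto
  have "(\<integral>x. x\<^sup>2 \<partial>density lborel (\<lambda>x. ennreal (normal_density 0 \<sigma> x))) =
        (\<integral>x. normal_density 0 \<sigma> x * (x - 0)^(2*1) \<partial>lborel)"
    by (subst integral_real_density) auto
  then show "(\<integral>x. x\<^sup>2 \<partial>density lborel (\<lambda>x. ennreal (normal_density 0 \<sigma> x))) = \<sigma>\<^sup>2"
    using integral_normal_moment_even[OF assms, of 0 1] by (simp add: fact_numeral)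
qed

lemma char_normal:
  assumes "0 < \<sigma>"
  shows "char (density lborel (\<lambda>x. ennreal (normal_density 0 \<sigma> x))) t = exp (- (\<sigma>\<^sup>2 * t\<^sup>2 / 2))"
proof -
  have "char (density lborel (\<lambda>x. ennreal (normal_density 0 \<sigma> x))) t =
        (\<integral>x. normal_density 0 \<sigma> x *\<^sub>R iexp (t * x) \<partial>lborel)"
    unfolding char_def by (subst integral_density) auto
  also have "\<dots> = \<bar>\<sigma>\<bar> *\<^sub>R (\<integral>x. normal_density 0 \<sigma> (0 + \<sigma> * x) *\<^sub>R iexp (t * (0 + \<sigma> * x)) \<partial>lborel)"
    using assms by (intro lborel_integral_real_affine) auto
  also have "\<dots> = (\<integral>x. \<bar>\<sigma>\<bar> *\<^sub>R (normal_density 0 \<sigma> (0 + \<sigma> * x) *\<^sub>R iexp (t * (0 + \<sigma> * x))) \<partial>lborel)"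
    by (rule integral_scaleR_right[symmetric])
  also have "\<dots> = (\<integral>x. std_normal_density x *\<^sub>R iexp ((t * \<sigma>) * x) \<partial>lborel)"
    using assms
    by (intro Bochner_Integration.integral_cong refl)
       (simp add: normal_density_def real_sqrt_mult power_mult_distrib field_simps del: scaleR_conv_of_real)
  also have "\<dots> = char std_normal_distribution (t * \<sigma>)"
    unfolding char_def by (subst integral_density) auto
  also have "\<dots> = exp (- (\<sigma>\<^sup>2 * t\<^sup>2 / 2))"
    by (simp add: char_std_normal_distribution power_mult_distrib mult.commute)
  finally show ?thesis .
qed

text \<open>The characteristic function is needed only at 1, because \<open>Y\<close> will be a
  whole linear combination whose coefficients absorb the argument. The point mass at 0 fits the same
  formula with variance 0.\<close>

lemma centered_gaussian_variable:
  assumes "prob_space M" and Y[measurable]: "Y \<in> borel_measurable M"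
    and "gaussian_law (distr M borel Y)" "(\<integral>\<omega>. Y \<omega> \<partial>M) = 0"
  shows "integrable M (\<lambda>\<omega>. (Y \<omega>)\<^sup>2)"
    and "(\<integral>\<omega>. iexp (Y \<omega>) \<partial>M) = exp (- ((\<integral>\<omega>. (Y \<omega>)\<^sup>2 \<partial>M) / 2))"
proof -
  interpret prob_space M by fact
  define L where "L = distr M borel Y"
  have sq: "integrable M (\<lambda>\<omega>. (Y \<omega>)\<^sup>2) \<longleftrightarrow> integrable L (\<lambda>x. x\<^sup>2)"
    unfolding L_def by (subst integrable_distr_eq) auto
  have mom: "(\<integral>\<omega>. (Y \<omega>)\<^sup>2 \<partial>M) = (\<integral>x. x\<^sup>2 \<partial>L)"
    unfolding L_def by (subst integral_distr) auto
  have ch: "(\<integral>\<omega>. iexp (Y \<omega>) \<partial>M) = char L 1"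
    unfolding L_def char_def by (subst integral_distr) auto
  have "(\<integral>x. x \<partial>L) = 0"
    unfolding L_def using assms(4) by (subst integral_distr) auto
  with assms(3) have "integrable L (\<lambda>x. x\<^sup>2) \<and> char L 1 = exp (- ((\<integral>x. x\<^sup>2 \<partial>L) / 2))"
    unfolding L_def[symmetric]
  proof (cases rule: gaussian_law_centered_cases)
    case 1
    have "integrable (return borel (0::real)) (\<lambda>x. x\<^sup>2)"
      by (rule finite_measure.integrable_const_bound[of _ _ 0])
        (auto simp: AE_return intro!: prob_space.finite_measure prob_space_return)
    then show ?thesis by (simp add: 1 char_def integral_return)
  next
    case (2 \<sigma>)
    then show ?thesis using normal_second_moment[of \<sigma>] char_normal[of \<sigma> 1] by simp
  qed
  then show "integrable M (\<lambda>\<omega>. (Y \<omega>)\<^sup>2)"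
    and "(\<integral>\<omega>. iexp (Y \<omega>) \<partial>M) = exp (- ((\<integral>\<omega>. (Y \<omega>)\<^sup>2 \<partial>M) / 2))"
    using sq mom ch by auto
qed

text \<open>Markov's inequality for exp (Y^2 / (4 \<sigma>^2)), whose mean is sqrt 2. The constant 4
  in place of the sharp 2 keeps this mean finite; replacing the variance by its upper bound
  \<open>s\<close> only weakens the estimate.\<close>

lemma gaussian_tail:
  assumes "prob_space M" and Y[measurable]: "Y \<in> borel_measurable M"
    and "gaussian_law (distr M borel Y)" "(\<integral>\<omega>. Y \<omega> \<partial>M) = 0"
    and "(\<integral>\<omega>. (Y \<omega>)\<^sup>2 \<partial>M) \<le> s" "0 < s" "0 < x"
  shows "measure M {\<omega> \<in> space M. x < \<bar>Y \<omega>\<bar>} \<le> 2 * exp (- (x\<^sup>2 / (4 * s)))"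
proof -
  interpret prob_space M by fact
  define L where "L = distr M borel Y"
  have mean: "(\<integral>x. x \<partial>L) = 0"
    unfolding L_def using assms(4) by (subst integral_distr) auto
  have var: "(\<integral>\<omega>. (Y \<omega>)\<^sup>2 \<partial>M) = (\<integral>x. x\<^sup>2 \<partial>L)"
    unfolding L_def by (subst integral_distr) auto
  have "measure M {\<omega> \<in> space M. x < \<bar>Y \<omega>\<bar>} = measure L {y. x < \<bar>y\<bar>}"
    unfolding L_def by (subst measure_distr) (auto intro!: arg_cong[where f="measure M"])
  also from assms(3) mean have "measure L {y. x < \<bar>y\<bar>} \<le> 2 * exp (- (x\<^sup>2 / (4 * s)))"
    unfolding L_def[symmetric]
  proof (cases rule: gaussian_law_centered_cases)
    case 1
    then show ?thesis using \<open>0 < x\<close> by (simp add: measure_return)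
  next
    case (2 \<sigma>)
    have \<sigma>: "\<sigma>\<^sup>2 \<le> s" using assms(5) var normal_second_moment(2)[OF 2(1)] 2(2) by simp
    \<comment> \<open>The exponential weight halves the exponent of the density, which doubles the
      variance; sqrt 2 corrects the normalisation.\<close>
    have eq: "normal_density 0 \<sigma> y * exp (y\<^sup>2 / (4 * \<sigma>\<^sup>2)) = sqrt 2 * normal_density 0 (sqrt 2 * \<sigma>) y" for y
      using 2(1)
      by (simp add: normal_density_def real_sqrt_mult power_mult_distrib field_simps flip: exp_add)
    have int: "integrable L (\<lambda>y. exp (y\<^sup>2 / (4 * \<sigma>\<^sup>2)))"
      unfolding 2(2) using 2(1) by (subst integrable_real_density) (auto simp: eq)
    have val: "(\<integral>y. exp (y\<^sup>2 / (4 * \<sigma>\<^sup>2)) \<partial>L) = sqrt 2"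
      unfolding 2(2) using 2(1) by (subst integral_real_density) (auto simp: eq)
    have "measure L {y. x < \<bar>y\<bar>} \<le> measure L {y \<in> space L. exp (y\<^sup>2 / (4 * \<sigma>\<^sup>2)) \<ge> exp (x\<^sup>2 / (4 * \<sigma>\<^sup>2))}"
    proof (rule finite_measure.finite_measure_mono)
      show "finite_measure L" unfolding L_def by (intro prob_space.finite_measure prob_space_distr) auto
      show "{y. x < \<bar>y\<bar>} \<subseteq> {y \<in> space L. exp (y\<^sup>2 / (4 * \<sigma>\<^sup>2)) \<ge> exp (x\<^sup>2 / (4 * \<sigma>\<^sup>2))}"
        using 2(1) \<open>0 < x\<close> by (auto simp: L_def abs_le_square_iff[symmetric] intro!: divide_right_mono)
    qed (auto simp: L_def)
    also have "\<dots> \<le> sqrt 2 / exp (x\<^sup>2 / (4 * \<sigma>\<^sup>2))"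
      using integral_Markov_inequality_measure[OF int, where A="{}" and c="exp (x\<^sup>2 / (4 * \<sigma>\<^sup>2))"] val by simp
    also have "\<dots> = sqrt 2 * exp (- (x\<^sup>2 / (4 * \<sigma>\<^sup>2)))" by (simp add: exp_minus field_simps)
    also have "\<dots> \<le> 2 * exp (- (x\<^sup>2 / (4 * s)))"
      using \<sigma> 2(1) \<open>0 < s\<close> sqrt2_less_2 by (intro mult_mono) (auto intro!: divide_left_mono)
    finally show ?thesis .
  qed
  finally show ?thesis .
qed

section \<open>Products of standard normal laws and the duality formula\<close>

lemma prob_space_std_gauss: "prob_space std_gauss"
  by (simp add: prob_space_normal_density)

text \<open>Multiplied by the standard normal density, the integrand is \<open>s\<close> times the
  centered normal density with standard deviation \<open>s\<close> = 1 / sqrt (1 + w), so its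
  integral is \<open>s\<close>.\<close>

lemma std_gauss_integral_exp_square:
  assumes "0 \<le> w"
  shows "integrable std_gauss (\<lambda>x. exp (- (w * x\<^sup>2 / 2)))"
    and "(\<integral>x. exp (- (w * x\<^sup>2 / 2)) \<partial>std_gauss) = (1 + w) powr (-1/2)"
proof -
  define s where "s = 1 / sqrt (1 + w)"
  have s: "0 < s" "s\<^sup>2 = 1 / (1 + w)" using assms by (auto simp: s_def power_divide)
  have eq: "std_normal_density x * exp (- (w * x\<^sup>2 / 2)) = s * normal_density 0 s x" for x
  proof -
    have "s * normal_density 0 s x = (1 / sqrt (2 * pi)) * exp (- (x\<^sup>2 * (1 + w)) / 2)"
      using assms s by (simp add: normal_density_def real_sqrt_mult real_sqrt_divide s_def)
    then show ?thesis by (simp add: std_normal_density_def field_simps flip: exp_add)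
  qed
  show "integrable std_gauss (\<lambda>x. exp (- (w * x\<^sup>2 / 2)))"
    using s(1) by (subst integrable_real_density) (auto simp: eq)
  have "(\<integral>x. exp (- (w * x\<^sup>2 / 2)) \<partial>std_gauss) = s"
    using s(1) by (subst integral_real_density) (auto simp: eq)
  also have "s = (1 + w) powr (-1/2)"
    using assms powr_minus[of "1 + w" "1/2"] by (simp add: s_def powr_half_sqrt inverse_eq_divide)
  finally show "(\<integral>x. exp (- (w * x\<^sup>2 / 2)) \<partial>std_gauss) = (1 + w) powr (-1/2)" .
qed

abbreviation gauss_prod :: "'i set \<Rightarrow> ('i \<Rightarrow> real) measure" where
  "gauss_prod I \<equiv> Pi\<^sub>M I (\<lambda>_. std_gauss)"

lemma prob_space_gauss_prod: "prob_space (gauss_prod I)"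
  by (intro prob_space_PiM prob_space_std_gauss)

lemma product_sigma_finite_std_gauss: "product_sigma_finite (\<lambda>_. std_gauss)"
  by (simp add: product_sigma_finite_def prob_space_imp_sigma_finite prob_space_std_gauss)

lemma gauss_prod_integral_exp_square:
  assumes "finite I" "\<And>i. i \<in> I \<Longrightarrow> 0 \<le> w i"
  shows "integrable (gauss_prod I) (\<lambda>g. exp (- ((\<Sum>i\<in>I. w i * (g i)\<^sup>2) / 2)))"
    and "(\<integral>g. exp (- ((\<Sum>i\<in>I. w i * (g i)\<^sup>2) / 2)) \<partial>gauss_prod I) = (\<Prod>i\<in>I. (1 + w i) powr (-1/2))"
proof -
  interpret product_sigma_finite "\<lambda>_. std_gauss" by (rule product_sigma_finite_std_gauss)
  have eq: "exp (- ((\<Sum>i\<in>I. w i * (g i)\<^sup>2) / 2)) = (\<Prod>i\<in>I. exp (- (w i * (g i)\<^sup>2 / 2)))" for g :: "'a \<Rightarrow> real"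
    using assms(1) by (simp add: sum_divide_distrib exp_sum flip: sum_negf)
  show "integrable (gauss_prod I) (\<lambda>g. exp (- ((\<Sum>i\<in>I. w i * (g i)\<^sup>2) / 2)))"
    unfolding eq using assms by (intro product_integrable_prod) (auto intro: std_gauss_integral_exp_square)
  have "(\<integral>g. exp (- ((\<Sum>i\<in>I. w i * (g i)\<^sup>2) / 2)) \<partial>gauss_prod I) =
        (\<Prod>i\<in>I. \<integral>x. exp (- (w i * x\<^sup>2 / 2)) \<partial>std_gauss)"
    unfolding eq using assms
    by (intro product_integral_prod) (auto intro: std_gauss_integral_exp_square)
  also have "\<dots> = (\<Prod>i\<in>I. (1 + w i) powr (-1/2))"
    using assms by (intro prod.cong refl std_gauss_integral_exp_square) auto
  finally show "(\<integral>g. exp (- ((\<Sum>i\<in>I. w i * (g i)\<^sup>2) / 2)) \<partial>gauss_prod I) = (\<Prod>i\<in>I. (1 + w i) powr (-1/2))" .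
qed

lemma gauss_prod_char:
  assumes "finite I"
  shows "(\<integral>g. iexp (\<Sum>i\<in>I. a i * g i) \<partial>gauss_prod I) = exp (- ((\<Sum>i\<in>I. (a i)\<^sup>2) / 2))"
proof -
  interpret product_sigma_finite "\<lambda>_. std_gauss" by (rule product_sigma_finite_std_gauss)
  interpret G: prob_space std_gauss by (rule prob_space_std_gauss)
  have eq: "iexp (\<Sum>i\<in>I. a i * g i) = (\<Prod>i\<in>I. iexp (a i * g i))" for g :: "'a \<Rightarrow> real"
    using assms by (simp add: sum_distrib_left exp_sum)
  have "(\<integral>g. iexp (\<Sum>i\<in>I. a i * g i) \<partial>gauss_prod I) = (\<Prod>i\<in>I. \<integral>x. iexp (a i * x) \<partial>std_gauss)"
    unfolding eq using assms
    by (intro product_integral_prod) (auto intro!: G.integrable_const_bound[of _ 1])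
  also have "\<dots> = (\<Prod>i\<in>I. complex_of_real (exp (- (a i)\<^sup>2 / 2)))"
    using char_std_normal_distribution by (intro prod.cong refl) (simp add: char_def fun_eq_iff)
  also have "\<dots> = exp (- ((\<Sum>i\<in>I. (a i)\<^sup>2) / 2))"
    using assms by (simp add: sum_divide_distrib exp_sum flip: sum_negf)
  finally show ?thesis .
qed

text \<open>Both sides are the double expectation of \<open>iexp\<close> of the sum of g_i Y_i:
  integrating over \<open>g\<close> first gives the left side, over \<omega> first the right side.
  \<open>V\<close> is abstract so that the formula applies to the process and also to auxiliary
  Gaussian vectors; the integrability claim is a by-product of Fubini.\<close>

lemma gauss_duality:
  fixes Y :: "'i \<Rightarrow> 'a \<Rightarrow> real" and V :: "('i \<Rightarrow> real) \<Rightarrow> real"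
  assumes "prob_space M" "finite I" and Y[measurable]: "\<And>i. i \<in> I \<Longrightarrow> Y i \<in> borel_measurable M"
    and V: "\<And>g. (\<integral>\<omega>. iexp (\<Sum>i\<in>I. g i * Y i \<omega>) \<partial>M) = exp (- (V g / 2))"
  shows "(\<integral>\<omega>. exp (- ((\<Sum>i\<in>I. (Y i \<omega>)\<^sup>2) / 2)) \<partial>M) = (\<integral>g. exp (- (V g / 2)) \<partial>gauss_prod I)"
    and "integrable (gauss_prod I) (\<lambda>g. exp (- (V g / 2)))"
proof -
  interpret M: prob_space M by fact
  interpret G: prob_space "gauss_prod I" by (rule prob_space_gauss_prod)
  interpret P: pair_prob_space "gauss_prod I" M ..
  have int: "integrable (gauss_prod I \<Otimes>\<^sub>M M) (\<lambda>(g, \<omega>). iexp (\<Sum>i\<in>I. g i * Y i \<omega>))"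
    by (rule P.P.integrable_const_bound[of _ 1]) (auto simp: split_beta)
  have "complex_of_real (\<integral>\<omega>. exp (- ((\<Sum>i\<in>I. (Y i \<omega>)\<^sup>2) / 2)) \<partial>M) =
        (\<integral>\<omega>. (\<integral>g. iexp (\<Sum>i\<in>I. g i * Y i \<omega>) \<partial>gauss_prod I) \<partial>M)"
    by (subst integral_complex_of_real[symmetric])
       (intro Bochner_Integration.integral_cong refl, subst gauss_prod_char[OF assms(2), symmetric], simp add: mult.commute)
  also have "\<dots> = (\<integral>g. (\<integral>\<omega>. iexp (\<Sum>i\<in>I. g i * Y i \<omega>) \<partial>M) \<partial>gauss_prod I)"
    by (rule P.Fubini_integral[OF int])
  also have "\<dots> = complex_of_real (\<integral>g. exp (- (V g / 2)) \<partial>gauss_prod I)"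
    by (simp only: V integral_complex_of_real)
  finally show "(\<integral>\<omega>. exp (- ((\<Sum>i\<in>I. (Y i \<omega>)\<^sup>2) / 2)) \<partial>M) = (\<integral>g. exp (- (V g / 2)) \<partial>gauss_prod I)"
    by (simp only: of_real_eq_iff)
  have "integrable (gauss_prod I) (\<lambda>g. \<integral>\<omega>. iexp (\<Sum>i\<in>I. g i * Y i \<omega>) \<partial>M)"
    using P.integrable_fst'[OF int] by simp
  then show "integrable (gauss_prod I) (\<lambda>g. exp (- (V g / 2)))"
    unfolding V by (simp only: complex_of_real_integrable_eq)
qed

section \<open>Gaussian processes with a spectral density\<close>

text \<open>The dominating form is itself the variance form of a Gaussian vector \<open>Y\<close>,
  built linearly from independent normals \<open>h\<close> indexed by \<open>P <+> I\<close>.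
  Duality turns the integral into the mean of exp (- |Y|^2 / 2), and Cauchy-Schwarz bounds |Y|^2 by
  a diagonal form in \<open>h\<close>, whose integral is an explicit product. The large weight 2
  \<Lambda> falls on the \<open>card P\<close> coordinates only; the others carry 2 \<theta>. No
  eigenvalues have to be computed.\<close>

lemma gauss_prod_low_rank:
  fixes A :: "'p \<Rightarrow> 'i \<Rightarrow> real" and V :: "('i \<Rightarrow> real) \<Rightarrow> real"
  assumes "finite P" "finite I" "0 \<le> \<theta>"
    and V: "\<And>g. V g \<le> (\<Sum>p\<in>P. (\<Sum>i\<in>I. A p i * g i)\<^sup>2) + \<theta> * (\<Sum>i\<in>I. (g i)\<^sup>2)"
    and int: "integrable (gauss_prod I) (\<lambda>g. exp (- (V g / 2)))"
    and \<Lambda>: "(\<Sum>i\<in>I. \<Sum>p\<in>P. (A p i)\<^sup>2) \<le> \<Lambda>"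
  shows "(1 + 2 * \<Lambda>) powr (- real (card P) / 2) * (1 + 2 * \<theta>) powr (- real (card I) / 2)
         \<le> (\<integral>g. exp (- (V g / 2)) \<partial>gauss_prod I)"
proof -
  define J where "J = P <+> I"
  \<comment> \<open>The matrix that generates \<open>Y\<close>: the rows of \<open>A\<close>,
    followed by sqrt \<theta> times the identity. Its squared rows reproduce the two terms of the
    hypothesis on \<open>V\<close>.\<close>
  define a where "a = case_sum A (\<lambda>j i. if i = j then sqrt \<theta> else 0)"
  define w where "w = case_sum (\<lambda>_::'p. 2 * \<Lambda>) (\<lambda>_::'i. 2 * \<theta>)"
  define V' where "V' g = (\<Sum>q\<in>J. (\<Sum>i\<in>I. g i * a q i)\<^sup>2)" for g
  define Y where "Y i h = (\<Sum>q\<in>J. a q i * h q)" for i and h :: "'p + 'i \<Rightarrow> real"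
  have finJ: "finite J" using assms by (simp add: J_def)
  have "0 \<le> \<Lambda>" by (rule order_trans[OF _ \<Lambda>]) (auto intro!: sum_nonneg)
  have w: "0 \<le> w q" for q using \<open>0 \<le> \<Lambda>\<close> \<open>0 \<le> \<theta>\<close> by (cases q) (auto simp: w_def)
  have V': "V' g = (\<Sum>p\<in>P. (\<Sum>i\<in>I. A p i * g i)\<^sup>2) + \<theta> * (\<Sum>i\<in>I. (g i)\<^sup>2)" for g
  proof -
    have "(\<Sum>i\<in>I. g i * (if i = j then sqrt \<theta> else 0)) = g j * sqrt \<theta>" if "j \<in> I" for j
      using that \<open>finite I\<close> by (simp add: if_distrib cong: if_cong)
    then show ?thesis
      using assms by (simp add: V'_def J_def a_def sum.Plus sum_distrib_left power_mult_distrib mult.commute)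
  qed
  have ch: "(\<integral>h. iexp (\<Sum>i\<in>I. g i * Y i h) \<partial>gauss_prod J) = exp (- (V' g / 2))" for g
  proof -
    have "(\<Sum>i\<in>I. g i * Y i h) = (\<Sum>q\<in>J. (\<Sum>i\<in>I. g i * a q i) * h q)" for h
      unfolding Y_def sum_distrib_left sum_distrib_right by (subst sum.swap) (simp add: mult.assoc)
    then show ?thesis
      unfolding V'_def by (simp only: gauss_prod_char[OF finJ])
  qed
  have Ym: "Y i \<in> borel_measurable (gauss_prod J)" for i
    unfolding Y_def by measurable
  note dual = gauss_duality[OF prob_space_gauss_prod \<open>finite I\<close> Ym ch]
  have Ybound: "(\<Sum>i\<in>I. (Y i h)\<^sup>2) \<le> (\<Sum>q\<in>J. w q * (h q)\<^sup>2)" for h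
  proof -
    \<comment> \<open>Splitting off the diagonal part costs the factor 2, the source of the weights
      2 \<Lambda> and 2 \<theta> in \<open>w\<close>.\<close>
    have Yi: "(Y i h)\<^sup>2 \<le> 2 * ((\<Sum>p\<in>P. (A p i)\<^sup>2) * (\<Sum>p\<in>P. (h (Inl p))\<^sup>2)) + 2 * (\<theta> * (h (Inr i))\<^sup>2)"
      if "i \<in> I" for i
    proof -
      have "(\<Sum>j\<in>I. (if i = j then sqrt \<theta> else 0) * h (Inr j)) = sqrt \<theta> * h (Inr i)"
        using that \<open>finite I\<close> by (simp add: if_distrib if_distribR cong: if_cong)
      then have "Y i h = (\<Sum>p\<in>P. A p i * h (Inl p)) + sqrt \<theta> * h (Inr i)"
        using assms by (simp add: Y_def J_def a_def sum.Plus)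
      then have "(Y i h)\<^sup>2 \<le> 2 * (\<Sum>p\<in>P. A p i * h (Inl p))\<^sup>2 + 2 * (sqrt \<theta> * h (Inr i))\<^sup>2"
        using sum_squares_bound[of "\<Sum>p\<in>P. A p i * h (Inl p)" "sqrt \<theta> * h (Inr i)"]
        by (simp add: power2_sum)
      also have "\<dots> \<le> 2 * ((\<Sum>p\<in>P. (A p i)\<^sup>2) * (\<Sum>p\<in>P. (h (Inl p))\<^sup>2)) + 2 * (\<theta> * (h (Inr i))\<^sup>2)"
        using Cauchy_Schwarz_ineq_sum[of "\<lambda>p. A p i" "\<lambda>p. h (Inl p)" P] \<open>0 \<le> \<theta>\<close>
        by (simp add: power_mult_distrib)
      finally show ?thesis .
    qed
    have "(\<Sum>i\<in>I. (Y i h)\<^sup>2) \<le>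
        2 * ((\<Sum>i\<in>I. \<Sum>p\<in>P. (A p i)\<^sup>2) * (\<Sum>p\<in>P. (h (Inl p))\<^sup>2)) + 2 * (\<theta> * (\<Sum>i\<in>I. (h (Inr i))\<^sup>2))"
      using sum_mono[OF Yi, of I "\<lambda>i. i"]
      by (simp only: sum.distrib sum_distrib_left[symmetric] sum_distrib_right[symmetric])
    also have "\<dots> \<le> 2 * (\<Lambda> * (\<Sum>p\<in>P. (h (Inl p))\<^sup>2)) + 2 * (\<theta> * (\<Sum>i\<in>I. (h (Inr i))\<^sup>2))"
      using \<Lambda> by (intro add_mono mult_left_mono mult_right_mono) (auto intro!: sum_nonneg)
    also have "\<dots> = (\<Sum>q\<in>J. w q * (h q)\<^sup>2)"
      using assms by (simp add: J_def w_def sum.Plus sum_distrib_left mult.assoc)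
    finally show ?thesis .
  qed
  have "(1 + 2 * \<Lambda>) powr (- real (card P) / 2) * (1 + 2 * \<theta>) powr (- real (card I) / 2) =
        (\<Prod>q\<in>J. (1 + w q) powr (-1/2))"
    using assms \<open>0 \<le> \<Lambda>\<close> by (simp add: J_def w_def prod.Plus powr_power)
  also have "\<dots> = (\<integral>h. exp (- ((\<Sum>q\<in>J. w q * (h q)\<^sup>2) / 2)) \<partial>gauss_prod J)"
    using gauss_prod_integral_exp_square(2)[OF finJ, of w] w by simp
  also have "\<dots> \<le> (\<integral>h. exp (- ((\<Sum>i\<in>I. (Y i h)\<^sup>2) / 2)) \<partial>gauss_prod J)"
  proof (rule integral_mono)
    interpret prob_space "gauss_prod J" by (rule prob_space_gauss_prod)
    show "integrable (gauss_prod J) (\<lambda>h. exp (- ((\<Sum>i\<in>I. (Y i h)\<^sup>2) / 2)))"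
      using Ym by (intro integrable_const_bound[of _ 1]) (auto intro!: sum_nonneg)
  qed (use Ybound w finJ in \<open>auto intro!: gauss_prod_integral_exp_square\<close>)
  also have "\<dots> = (\<integral>g. exp (- (V' g / 2)) \<partial>gauss_prod I)"
    by (rule dual(1))
  also have "\<dots> \<le> (\<integral>g. exp (- (V g / 2)) \<partial>gauss_prod I)"
    using V V' by (intro integral_mono dual(2) int) (auto intro!: divide_right_mono)
  finally show ?thesis .
qed

text \<open>A general density \<open>f\<close> is kept because the two halves of the proof use it
  differently: one needs lower bounds on \<open>f\<close>, the other upper bounds.\<close>

locale spectral_gaussian = prob_space M for M :: "'a measure" +
  fixes X :: "real \<Rightarrow> 'a \<Rightarrow> real" and f :: "real \<Rightarrow> real"
  assumes gaussian: "gaussian_process M X"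
    and centered: "centered_process M X"
    and continuous: "continuous_paths M X"
    and spectral: "has_spectral_measure M X (density lborel (\<lambda>u. ennreal (f u)))"
    and f_measurable [measurable]: "f \<in> borel_measurable borel"
    and f_nonneg: "0 \<le> f u"
begin

lemma X_measurable [measurable]: "X t \<in> borel_measurable M"
  using gaussian by (simp add: gaussian_process_def)

lemma f_integrable: "integrable lborel f"
proof -
  interpret F: finite_measure "density lborel (\<lambda>u. ennreal (f u))"
    using spectral by (simp add: has_spectral_measure_def)
  have "integrable (density lborel (\<lambda>u. ennreal (f u))) (\<lambda>_. 1::real)" by simp
  then show ?thesis
    by (subst (asm) integrable_real_density) (auto simp: f_nonneg)
qed

text \<open>This is the variance of the linear combination of the X (t i) with coefficients
  \<open>g\<close>, in spectral form; see \<open>lin_variance\<close>.\<close>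

definition covar_form :: "'i set \<Rightarrow> ('i \<Rightarrow> real) \<Rightarrow> ('i \<Rightarrow> real) \<Rightarrow> real" where
  "covar_form I t g = (\<integral>u. f u * (cmod (\<Sum>i\<in>I. g i * iexp (t i * u)))\<^sup>2 \<partial>lborel)"

lemma integrable_f_bounded:
  fixes h :: "real \<Rightarrow> 'b::{banach,second_countable_topology}"
  assumes [measurable]: "h \<in> borel_measurable borel" and "\<And>u. norm (h u) \<le> C"
  shows "integrable lborel (\<lambda>u. f u *\<^sub>R h u)"
proof (rule Bochner_Integration.integrable_bound)
  show "integrable lborel (\<lambda>u. C * f u)" using f_integrable by simp
  have "f u * norm (h u) \<le> \<bar>C\<bar> * f u" for u
    using assms(2)[of u] f_nonneg[of u] by (simp add: mult.commute[of _ "f u"] mult_left_mono)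
  then show "AE u in lborel. norm (f u *\<^sub>R h u) \<le> norm (C * f u)"
    by (simp add: f_nonneg abs_mult)
qed measurable

lemma covar_integrable:
  fixes g :: "'i \<Rightarrow> real"
  shows "integrable lborel (\<lambda>u. f u * (cmod (\<Sum>i\<in>I. g i * iexp (t i * u)))\<^sup>2)"
proof -
  have "cmod (\<Sum>i\<in>I. g i * iexp (t i * u)) \<le> (\<Sum>i\<in>I. \<bar>g i\<bar>)" for u
    by (rule order_trans[OF norm_sum]) (simp add: norm_mult)
  then have "norm ((cmod (\<Sum>i\<in>I. g i * iexp (t i * u)))\<^sup>2) \<le> (\<Sum>i\<in>I. \<bar>g i\<bar>)\<^sup>2" for u
    by (auto intro!: power_mono)
  from integrable_f_bounded[OF _ this] show ?thesis by simp
qed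

lemma lin_mean: "(\<integral>\<omega>. (\<Sum>i\<in>I. g i * X (t i) \<omega>) \<partial>M) = 0" if "\<And>i. integrable M (X (t i))"
  using that centered by (simp add: centered_process_def)

text \<open>\<open>gaussian_process\<close> speaks of finite sets of times, whereas \<open>t\<close>
  may repeat values; indices with equal time are grouped and their coefficients added.\<close>

lemma lin_gaussian:
  assumes "finite I"
  shows "gaussian_law (distr M borel (\<lambda>\<omega>. \<Sum>i\<in>I. g i * X (t i) \<omega>))"
proof -
  have "(\<Sum>i\<in>I. g i * X (t i) \<omega>) = (\<Sum>s\<in>t ` I. (\<Sum>i\<in>{i\<in>I. t i = s}. g i) * X s \<omega>)" for \<omega>
  proof -
    have "(\<Sum>i\<in>I. g i * X (t i) \<omega>) = (\<Sum>s\<in>t ` I. \<Sum>i\<in>{i\<in>I. t i = s}. g i * X (t i) \<omega>)"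
      using assms by (rule sum.image_gen)
    also have "\<dots> = (\<Sum>s\<in>t ` I. (\<Sum>i\<in>{i\<in>I. t i = s}. g i) * X s \<omega>)"
      by (intro sum.cong refl) (simp add: sum_distrib_right)
    finally show ?thesis .
  qed
  then show ?thesis
    using gaussian assms by (simp add: gaussian_process_def)
qed

lemma X_square_integrable: "integrable M (\<lambda>\<omega>. (X t \<omega>)\<^sup>2)"
proof (rule centered_gaussian_variable)
  show "gaussian_law (distr M borel (X t))"
    using lin_gaussian[of "{()}" "\<lambda>_. 1" "\<lambda>_. t"] by simp
  show "(\<integral>\<omega>. X t \<omega> \<partial>M) = 0" using centered by (simp add: centered_process_def)
qed (simp_all add: prob_space_axioms)

lemma X_integrable: "integrable M (X t)"
  by (rule square_integrable_imp_integrable[OF _ X_square_integrable]) simp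

lemma X_mult_integrable: "integrable M (\<lambda>\<omega>. X s \<omega> * X t \<omega>)"
proof (rule Bochner_Integration.integrable_bound)
  show "integrable M (\<lambda>\<omega>. (X s \<omega>)\<^sup>2 + (X t \<omega>)\<^sup>2)"
    by (intro Bochner_Integration.integrable_add X_square_integrable)
  have "\<bar>x * y\<bar> \<le> x\<^sup>2 + y\<^sup>2" for x y :: real
    using sum_squares_bound[of x y] sum_squares_bound[of "-x" y] by (simp add: abs_le_iff)
  then show "AE \<omega> in M. norm (X s \<omega> * X t \<omega>) \<le> norm ((X s \<omega>)\<^sup>2 + (X t \<omega>)\<^sup>2)"
    by simp
qed simp

text \<open>After expansion of the square every covariance is replaced by its spectral integral. The
  double sum under the integral is z times its conjugate, where z is the exponential sum.\<close>

lemma lin_variance: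
  assumes "finite I"
  shows "(\<integral>\<omega>. (\<Sum>i\<in>I. g i * X (t i) \<omega>)\<^sup>2 \<partial>M) = covar_form I t g"
proof -
  have cov: "complex_of_real (\<integral>\<omega>. X s \<omega> * X t \<omega> \<partial>M) = (\<integral>u. f u *\<^sub>R iexp ((s - t) * u) \<partial>lborel)" for s t
    using spectral unfolding has_spectral_measure_def by (subst (asm) integral_density) (auto simp: f_nonneg)
  have ints: "integrable lborel (\<lambda>u. f u *\<^sub>R iexp (s * u))" for s
    by (rule integrable_f_bounded[of _ 1]) auto
  have "complex_of_real (\<integral>\<omega>. (\<Sum>i\<in>I. g i * X (t i) \<omega>)\<^sup>2 \<partial>M) =
        complex_of_real (\<integral>\<omega>. (\<Sum>i\<in>I. \<Sum>j\<in>I. (g i * g j) * (X (t i) \<omega> * X (t j) \<omega>)) \<partial>M)"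
    by (simp add: power2_eq_square sum_product mult_ac)
  also have "\<dots> = (\<Sum>i\<in>I. \<Sum>j\<in>I. (g i * g j) * complex_of_real (\<integral>\<omega>. X (t i) \<omega> * X (t j) \<omega> \<partial>M))"
    by (simp add: X_mult_integrable)
  also have "\<dots> = (\<integral>u. (\<Sum>i\<in>I. \<Sum>j\<in>I. (g i * g j) * (f u *\<^sub>R iexp ((t i - t j) * u))) \<partial>lborel)"
    unfolding cov by (subst Bochner_Integration.integral_sum, intro Bochner_Integration.integrable_sum integrable_mult_right ints)+
      (simp only: integral_mult_right_zero)
  also have "\<dots> = (\<integral>u. complex_of_real (f u * (cmod (\<Sum>i\<in>I. g i * iexp (t i * u)))\<^sup>2) \<partial>lborel)"
  proof (intro Bochner_Integration.integral_cong refl)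
    fix u
    have "complex_of_real ((cmod (\<Sum>i\<in>I. g i * iexp (t i * u)))\<^sup>2) =
          (\<Sum>i\<in>I. g i * iexp (t i * u)) * cnj (\<Sum>i\<in>I. g i * iexp (t i * u))"
      by (rule complex_norm_square)
    also have "\<dots> = (\<Sum>i\<in>I. \<Sum>j\<in>I. (g i * g j) * iexp ((t i - t j) * u))"
      by (auto simp: sum_product exp_cnj algebra_simps exp_diff exp_minus field_simps intro!: sum.cong)
    finally show "(\<Sum>i\<in>I. \<Sum>j\<in>I. (g i * g j) * (f u *\<^sub>R iexp ((t i - t j) * u))) =
          complex_of_real (f u * (cmod (\<Sum>i\<in>I. g i * iexp (t i * u)))\<^sup>2)"
      by (simp add: sum_distrib_left mult_ac scaleR_conv_of_real)
  qed
  also have "\<dots> = complex_of_real (covar_form I t g)"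
    unfolding covar_form_def by (rule integral_complex_of_real)
  finally show ?thesis by (simp only: of_real_eq_iff)
qed

lemma lin_char:
  assumes "finite I"
  shows "(\<integral>\<omega>. iexp (\<Sum>i\<in>I. g i * X (t i) \<omega>) \<partial>M) = exp (- (covar_form I t g / 2))"
  unfolding lin_variance[OF assms, symmetric]
  by (intro centered_gaussian_variable(2) lin_gaussian assms lin_mean X_integrable prob_space_axioms) measurable

lemma covar_form_scale: "covar_form I t (\<lambda>i. c * g i) = c\<^sup>2 * covar_form I t g"
proof -
  have "(\<Sum>i\<in>I. complex_of_real (c * g i) * iexp (t i * u)) = c * (\<Sum>i\<in>I. g i * iexp (t i * u))" for u
    by (simp add: sum_distrib_left mult.assoc)
  then show ?thesis
    unfolding covar_form_def by (simp add: norm_mult power_mult_distrib mult.left_commute[of _ "c\<^sup>2"])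
qed

section \<open>Probabilities of finite-dimensional cubes\<close>

lemma exp_square_expectation:
  assumes "finite I"
  shows "(\<integral>\<omega>. exp (- (c\<^sup>2 * (\<Sum>i\<in>I. (X (t i) \<omega>)\<^sup>2) / 2)) \<partial>M) =
         (\<integral>g. exp (- (c\<^sup>2 * covar_form I t g / 2)) \<partial>gauss_prod I)"
    and "integrable (gauss_prod I) (\<lambda>g. exp (- (c\<^sup>2 * covar_form I t g / 2)))"
proof -
  have ch: "(\<integral>\<omega>. iexp (\<Sum>i\<in>I. g i * (c * X (t i) \<omega>)) \<partial>M) = exp (- (c\<^sup>2 * covar_form I t g / 2))" for g
    using lin_char[OF assms, of "\<lambda>i. c * g i" t] unfolding covar_form_scale by (simp add: mult_ac)
  note dual = gauss_duality[OF prob_space_axioms assms(1) _ ch]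
  show "(\<integral>\<omega>. exp (- (c\<^sup>2 * (\<Sum>i\<in>I. (X (t i) \<omega>)\<^sup>2) / 2)) \<partial>M) =
         (\<integral>g. exp (- (c\<^sup>2 * covar_form I t g / 2)) \<partial>gauss_prod I)"
    using dual(1) by (simp add: power_mult_distrib sum_distrib_left)
  show "integrable (gauss_prod I) (\<lambda>g. exp (- (c\<^sup>2 * covar_form I t g / 2)))"
    using dual(2) by simp
qed

text \<open>On the cube the sum of squares is at most \<open>card I\<close> times r^2, so
  \<open>E\<close> is at least exp (- card I / 2) there. Markov's inequality reduces the claim to
  the mean of \<open>E\<close>, which duality and the lower bound on the form control.\<close>

lemma prob_cube_le:
  assumes "finite I" "0 < r" "0 \<le> l" and V: "\<And>g. l * (\<Sum>i\<in>I. (g i)\<^sup>2) \<le> covar_form I t g"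
  shows "prob {\<omega> \<in> space M. \<forall>i\<in>I. \<bar>X (t i) \<omega>\<bar> \<le> r} \<le> exp (card I / 2) * (1 + l / r\<^sup>2) powr (- real (card I) / 2)"
proof -
  define E where "E \<omega> = exp (- ((1/r)\<^sup>2 * (\<Sum>i\<in>I. (X (t i) \<omega>)\<^sup>2) / 2))" for \<omega>
  have E: "integrable M E" unfolding E_def
    by (intro integrable_const_bound[of _ 1]) (auto intro!: sum_nonneg mult_nonneg_nonneg)
  have "prob {\<omega> \<in> space M. \<forall>i\<in>I. \<bar>X (t i) \<omega>\<bar> \<le> r} \<le> prob {\<omega> \<in> space M. E \<omega> \<ge> exp (- (card I / 2))}"
  proof (rule finite_measure_mono)
    have "exp (- (card I / 2)) \<le> E \<omega>" if "\<forall>i\<in>I. \<bar>X (t i) \<omega>\<bar> \<le> r" for \<omega>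
    proof -
      have "(\<Sum>i\<in>I. (X (t i) \<omega>)\<^sup>2) \<le> (\<Sum>i\<in>I. r\<^sup>2)"
        using that \<open>0 < r\<close> by (intro sum_mono) (simp add: abs_le_square_iff[symmetric])
      then show ?thesis using \<open>0 < r\<close> by (simp add: E_def power_divide field_simps)
    qed
    then show "{\<omega> \<in> space M. \<forall>i\<in>I. \<bar>X (t i) \<omega>\<bar> \<le> r} \<subseteq> {\<omega> \<in> space M. E \<omega> \<ge> exp (- (card I / 2))}"
      by auto
    show "{\<omega> \<in> space M. E \<omega> \<ge> exp (- (card I / 2))} \<in> events" unfolding E_def by measurable
  qed
  also have "\<dots> \<le> (\<integral>\<omega>. E \<omega> \<partial>M) / exp (- (card I / 2))"
    using integral_Markov_inequality_measure[OF E, where A="{}" and c="exp (- (card I / 2))"]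
    by (simp add: E_def)
  also have "\<dots> = exp (card I / 2) * (\<integral>\<omega>. E \<omega> \<partial>M)" by (simp add: exp_minus field_simps)
  also have "(\<integral>\<omega>. E \<omega> \<partial>M) = (\<integral>g. exp (- ((1/r)\<^sup>2 * covar_form I t g / 2)) \<partial>gauss_prod I)"
    unfolding E_def by (rule exp_square_expectation) fact
  also have "\<dots> \<le> (\<integral>g. exp (- ((\<Sum>i\<in>I. l / r\<^sup>2 * (g i)\<^sup>2) / 2)) \<partial>gauss_prod I)"
  proof (intro integral_mono exp_square_expectation gauss_prod_integral_exp_square assms)
    fix g
    have "(\<Sum>i\<in>I. l / r\<^sup>2 * (g i)\<^sup>2) = (1/r)\<^sup>2 * (l * (\<Sum>i\<in>I. (g i)\<^sup>2))"
      by (simp add: sum_distrib_left power_divide)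
    also have "\<dots> \<le> (1/r)\<^sup>2 * covar_form I t g"
      by (intro mult_left_mono V) auto
    finally show "exp (- ((1/r)\<^sup>2 * covar_form I t g / 2)) \<le> exp (- ((\<Sum>i\<in>I. l / r\<^sup>2 * (g i)\<^sup>2) / 2))"
      by simp
  qed (use \<open>0 \<le> l\<close> in auto)
  also have "\<dots> = (1 + l / r\<^sup>2) powr (- real (card I) / 2)"
    using assms by (subst gauss_prod_integral_exp_square) (auto simp: powr_power add_nonneg_eq_0_iff)
  finally show ?thesis by simp
qed

text \<open>Off the cube a single coordinate already makes \<open>E\<close> at most the subtracted
  exponential, and on it \<open>E\<close> is at most 1. The scale \<epsilon> is free: the smaller it
  is against \<rho>, the smaller the error term.\<close>

lemma prob_cube_ge:
  assumes "finite I" "0 < \<epsilon>" "0 < \<rho>"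
  shows "(\<integral>g. exp (- (covar_form I t g / \<epsilon>\<^sup>2 / 2)) \<partial>gauss_prod I) - exp (- (\<rho>\<^sup>2 / (2 * \<epsilon>\<^sup>2)))
         \<le> prob {\<omega> \<in> space M. \<forall>i\<in>I. \<bar>X (t i) \<omega>\<bar> \<le> \<rho>}"
proof -
  define E where "E \<omega> = exp (- ((1/\<epsilon>)\<^sup>2 * (\<Sum>i\<in>I. (X (t i) \<omega>)\<^sup>2) / 2))" for \<omega>
  define S where "S = {\<omega> \<in> space M. \<forall>i\<in>I. \<bar>X (t i) \<omega>\<bar> \<le> \<rho>}"
  have S[measurable]: "S \<in> events"
    unfolding S_def using assms(1) by measurable
  have E: "integrable M E" unfolding E_def
    by (intro integrable_const_bound[of _ 1]) (auto intro!: sum_nonneg mult_nonneg_nonneg)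
  have "E \<omega> \<le> indicator S \<omega> + exp (- (\<rho>\<^sup>2 / (2 * \<epsilon>\<^sup>2)))" if \<omega>: "\<omega> \<in> space M" for \<omega>
  proof (cases "\<omega> \<in> S")
    case True
    have "E \<omega> \<le> 1" unfolding E_def by (auto intro!: sum_nonneg mult_nonneg_nonneg)
    then show ?thesis using True by (simp add: add_increasing2)
  next
    case False
    then obtain j where j: "j \<in> I" "\<rho> < \<bar>X (t j) \<omega>\<bar>" using \<omega> by (auto simp: S_def not_le)
    then have "\<rho>\<^sup>2 \<le> (X (t j) \<omega>)\<^sup>2" using \<open>0 < \<rho>\<close> by (simp add: abs_le_square_iff[symmetric])
    also have "\<dots> \<le> (\<Sum>i\<in>I. (X (t i) \<omega>)\<^sup>2)" using assms(1) j(1) by (intro member_le_sum) auto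
    finally have "E \<omega> \<le> exp (- (\<rho>\<^sup>2 / (2 * \<epsilon>\<^sup>2)))"
      using \<open>0 < \<epsilon>\<close> by (simp add: E_def power_divide field_simps)
    then show ?thesis using False by simp
  qed
  then have "(\<integral>\<omega>. E \<omega> \<partial>M) \<le> (\<integral>\<omega>. indicator S \<omega> + exp (- (\<rho>\<^sup>2 / (2 * \<epsilon>\<^sup>2))) \<partial>M)"
    by (intro integral_mono E Bochner_Integration.integrable_add integrable_real_indicator S)
       (auto simp: less_top[symmetric])
  also have "\<dots> = prob S + exp (- (\<rho>\<^sup>2 / (2 * \<epsilon>\<^sup>2)))"
    using prob_space Int_absorb2[OF sets.sets_into_space[OF S]]
    by (subst Bochner_Integration.integral_add) (auto simp: less_top[symmetric])
  also have "(\<integral>\<omega>. E \<omega> \<partial>M) = (\<integral>g. exp (- ((1/\<epsilon>)\<^sup>2 * covar_form I t g / 2)) \<partial>gauss_prod I)"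
    unfolding E_def by (rule exp_square_expectation) fact
  also have "(\<lambda>g. exp (- ((1/\<epsilon>)\<^sup>2 * covar_form I t g / 2))) = (\<lambda>g. exp (- (covar_form I t g / \<epsilon>\<^sup>2 / 2)))"
    by (simp add: power_divide)
  finally show ?thesis unfolding S_def by simp
qed

lemma prob_cube_ge_low_rank:
  fixes A :: "'p \<Rightarrow> 'i \<Rightarrow> real"
  assumes "finite I" "finite P" "0 < \<epsilon>" "0 < \<rho>" "0 \<le> \<eta>"
    and V: "\<And>g. covar_form I t g \<le> (\<Sum>p\<in>P. (\<Sum>i\<in>I. A p i * g i)\<^sup>2) + \<eta> * (\<Sum>i\<in>I. (g i)\<^sup>2)"
    and \<Lambda>: "(\<Sum>i\<in>I. \<Sum>p\<in>P. (A p i)\<^sup>2) \<le> \<Lambda>"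
  shows "(1 + 2 * \<Lambda> / \<epsilon>\<^sup>2) powr (- real (card P) / 2) * (1 + 2 * \<eta> / \<epsilon>\<^sup>2) powr (- real (card I) / 2)
          - exp (- (\<rho>\<^sup>2 / (2 * \<epsilon>\<^sup>2)))
         \<le> prob {\<omega> \<in> space M. \<forall>i\<in>I. \<bar>X (t i) \<omega>\<bar> \<le> \<rho>}"
proof -
  have "(1 + 2 * (\<Lambda> / \<epsilon>\<^sup>2)) powr (- real (card P) / 2) * (1 + 2 * (\<eta> / \<epsilon>\<^sup>2)) powr (- real (card I) / 2)
        \<le> (\<integral>g. exp (- (covar_form I t g / \<epsilon>\<^sup>2 / 2)) \<partial>gauss_prod I)"
  proof (rule gauss_prod_low_rank[where A="\<lambda>p i. A p i / \<epsilon>"])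
    fix g
    have "(\<Sum>i\<in>I. A p i / \<epsilon> * g i)\<^sup>2 = (\<Sum>i\<in>I. A p i * g i)\<^sup>2 / \<epsilon>\<^sup>2" for p
      by (simp add: sum_divide_distrib[symmetric] power_divide)
    then show "covar_form I t g / \<epsilon>\<^sup>2 \<le> (\<Sum>p\<in>P. (\<Sum>i\<in>I. A p i / \<epsilon> * g i)\<^sup>2) + \<eta> / \<epsilon>\<^sup>2 * (\<Sum>i\<in>I. (g i)\<^sup>2)"
      using divide_right_mono[OF V[of g], of "\<epsilon>\<^sup>2"] by (simp add: sum_divide_distrib add_divide_distrib)
    show "(\<Sum>i\<in>I. \<Sum>p\<in>P. (A p i / \<epsilon>)\<^sup>2) \<le> \<Lambda> / \<epsilon>\<^sup>2"
      using divide_right_mono[OF \<Lambda>, of "\<epsilon>\<^sup>2"] by (simp add: sum_divide_distrib power_divide)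
    show "integrable (gauss_prod I) (\<lambda>g. exp (- (covar_form I t g / \<epsilon>\<^sup>2 / 2)))"
      using exp_square_expectation(2)[OF assms(1), of "1/\<epsilon>" t] by (simp add: power_divide)
  qed (use assms in auto)
  then show ?thesis using prob_cube_ge[OF assms(1,3,4), of t] by simp
qed

end

section \<open>Lower bounds for the variance form\<close>

text \<open>The operator sending p to p (u + h) - iexp (w l * h) p (u) annihilates the frequency
  \<open>w l\<close> and multiplies the coefficient of frequency \<open>w i\<close> by the displayed
  difference. Each application costs a factor 4 in the squared norm and lengthens the interval by
  \<open>h\<close>.\<close>

lemma difference_operator_bound:
  fixes b :: "'i \<Rightarrow> complex" and w :: "'i \<Rightarrow> real" and h lo hi :: real
  assumes "finite S" "0 \<le> h" "lo \<le> hi"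
  shows "integral {lo..hi} (\<lambda>u. (cmod (\<Sum>i\<in>I. b i * (\<Prod>l\<in>S. iexp (w i * h) - iexp (w l * h)) * iexp (w i * u)))\<^sup>2)
     \<le> 4 ^ card S * integral {lo..hi + card S * h} (\<lambda>u. (cmod (\<Sum>i\<in>I. b i * iexp (w i * u)))\<^sup>2)"
  using assms(1)
proof (induction S arbitrary: b rule: finite_induct)
  case empty
  then show ?case by simp
next
  case (insert l S)
  define p where "p u = (\<Sum>i\<in>I. b i * iexp (w i * u))" for u
  \<comment> \<open>Coefficients after the operator for \<open>l\<close> has acted. The induction
    hypothesis is applied to these, hence the generalisation over \<open>b\<close>.\<close>
  define b' where "b' i = b i * (iexp (w i * h) - iexp (w l * h))" for i
  define H where "H = hi + card S * h"
  have H: "lo \<le> H" using assms by (simp add: H_def add_increasing2)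
  have cont: "continuous_on A (\<lambda>u. (cmod (p u))\<^sup>2)" for A :: "real set"
    unfolding p_def by (intro continuous_intros)
  have cont': "continuous_on A (\<lambda>u. (cmod (p (u + h)))\<^sup>2)" for A :: "real set"
    unfolding p_def by (intro continuous_intros)
  have ints: "(\<lambda>u. (cmod (p u))\<^sup>2) integrable_on {a..b}" "(\<lambda>u. (cmod (p (u + h)))\<^sup>2) integrable_on {a..b}" for a b :: real
    by (intro integrable_continuous_interval cont cont')+
  have step: "(\<Sum>i\<in>I. b' i * iexp (w i * u)) = p (u + h) - iexp (w l * h) * p u" for u
    unfolding p_def b'_def sum_distrib_left sum_subtractf[symmetric]
    by (intro sum.cong refl) (simp add: algebra_simps exp_add)
  have "integral {lo..hi} (\<lambda>u. (cmod (\<Sum>i\<in>I. b i * (\<Prod>l\<in>insert l S. iexp (w i * h) - iexp (w l * h)) * iexp (w i * u)))\<^sup>2)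
      = integral {lo..hi} (\<lambda>u. (cmod (\<Sum>i\<in>I. b' i * (\<Prod>l\<in>S. iexp (w i * h) - iexp (w l * h)) * iexp (w i * u)))\<^sup>2)"
    using insert.hyps by (simp add: b'_def mult.assoc)
  also have "\<dots> \<le> 4 ^ card S * integral {lo..H} (\<lambda>u. (cmod (\<Sum>i\<in>I. b' i * iexp (w i * u)))\<^sup>2)"
    unfolding H_def by (rule insert.IH)
  also have "integral {lo..H} (\<lambda>u. (cmod (\<Sum>i\<in>I. b' i * iexp (w i * u)))\<^sup>2)
      \<le> integral {lo..H} (\<lambda>u. 2 * (cmod (p (u + h)))\<^sup>2 + 2 * (cmod (p u))\<^sup>2)"
  proof (intro integral_le)
    show "(\<lambda>u. (cmod (\<Sum>i\<in>I. b' i * iexp (w i * u)))\<^sup>2) integrable_on {lo..H}"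
      by (intro integrable_continuous_interval continuous_intros)
    show "(\<lambda>u. 2 * (cmod (p (u + h)))\<^sup>2 + 2 * (cmod (p u))\<^sup>2) integrable_on {lo..H}"
      by (intro integrable_continuous_interval continuous_intros cont cont')
    fix u
    have "cmod (p (u + h) - iexp (w l * h) * p u) \<le> cmod (p (u + h)) + cmod (p u)"
      by (rule order_trans[OF norm_triangle_ineq4]) (simp add: norm_mult)
    then have "(cmod (p (u + h) - iexp (w l * h) * p u))\<^sup>2 \<le> (cmod (p (u + h)) + cmod (p u))\<^sup>2"
      by (intro power_mono) auto
    also have "\<dots> \<le> 2 * (cmod (p (u + h)))\<^sup>2 + 2 * (cmod (p u))\<^sup>2"
      using sum_squares_bound[of "cmod (p (u + h))" "cmod (p u)"] by (simp add: power2_sum)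
    finally show "(cmod (\<Sum>i\<in>I. b' i * iexp (w i * u)))\<^sup>2 \<le> 2 * (cmod (p (u + h)))\<^sup>2 + 2 * (cmod (p u))\<^sup>2"
      unfolding step .
  qed
  also have "\<dots> = 2 * integral {lo..H} (\<lambda>u. (cmod (p (u + h)))\<^sup>2) + 2 * integral {lo..H} (\<lambda>u. (cmod (p u))\<^sup>2)"
    by (subst integral_add) (auto intro!: integrable_on_cmult_left ints)
  also have "integral {lo..H} (\<lambda>u. (cmod (p (u + h)))\<^sup>2) = integral {lo + h..H + h} (\<lambda>u. (cmod (p u))\<^sup>2)"
    using integral_shift[OF cont, of lo H h] by (simp add: o_def)
  also have "2 * integral {lo + h..H + h} (\<lambda>u. (cmod (p u))\<^sup>2) + 2 * integral {lo..H} (\<lambda>u. (cmod (p u))\<^sup>2)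
      \<le> 2 * integral {lo..H + h} (\<lambda>u. (cmod (p u))\<^sup>2) + 2 * integral {lo..H + h} (\<lambda>u. (cmod (p u))\<^sup>2)"
    using assms by (intro add_mono mult_left_mono integral_subset_le ints) auto
  finally show ?case
    using insert.hyps by (simp add: H_def p_def algebra_simps)
qed

text \<open>With z = x - y the modulus equals |exp (i z) - 1|, which is at least |z| - z^2 / 2, and
  z^2 is at most |z| here.\<close>

lemma iexp_diff_lower:
  assumes "\<bar>x - y\<bar> \<le> 1"
  shows "\<bar>x - y\<bar> / 2 \<le> cmod (iexp x - iexp y)"
proof -
  define z where "z = x - y"
  have "iexp x - iexp y = iexp y * (iexp z - 1)"
    by (simp add: z_def algebra_simps flip: exp_add)
  then have eq: "cmod (iexp x - iexp y) = cmod (iexp z - 1)" by (simp add: norm_mult)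
  have "cmod (iexp z - (1 + \<i> * z)) \<le> z\<^sup>2 / 2"
    using iexp_approx1[of z 1] by (simp add: numeral_2_eq_2)
  moreover have "cmod (\<i> * z) \<le> cmod (iexp z - 1) + cmod (iexp z - (1 + \<i> * z))"
    using norm_triangle_ineq4[of "iexp z - 1" "iexp z - (1 + \<i> * z)"] by simp
  moreover have "z\<^sup>2 \<le> \<bar>z\<bar>"
    using assms mult_left_mono[of "\<bar>z\<bar>" 1 "\<bar>z\<bar>"] by (simp add: z_def power2_eq_square)
  ultimately show ?thesis unfolding eq by (simp add: norm_mult flip: z_def)
qed

text \<open>For each \<open>j\<close> the operators of all other n - 1 frequencies are applied,
  leaving only the \<open>j\<close>-th term, whose factor is a product of n - 1 differences of size
  at least 1 / (2 n^2). Summing the resulting bounds for the single coefficients gives the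
  claim.\<close>

lemma exponential_sum_coefficient_bound:
  fixes g :: "nat \<Rightarrow> real" and n :: nat
  assumes "0 < n"
  shows "(\<Sum>j<n. (g j)\<^sup>2) \<le> (4 * real n ^ 2) ^ (2 * n)
     * integral {-1..1} (\<lambda>u. (cmod (\<Sum>j<n. g j * iexp (real j / n * u)))\<^sup>2)"
proof -
  \<comment> \<open>With this shift, n - 1 steps lengthen [-1, 0] by less than 1, so the enlarged
    interval stays inside [-1, 1].\<close>
  define h where "h = 1 / real n"
  define w where "w j = real j / n" for j
  define T where "T = integral {-1..1} (\<lambda>u. (cmod (\<Sum>j<n. g j * iexp (w j * u)))\<^sup>2)"
  have "0 \<le> T" unfolding T_def by (intro integral_nonneg integrable_continuous_interval continuous_intros) auto
  have n1: "1 \<le> real n" using assms by simp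
  have gj: "(g j)\<^sup>2 \<le> (4 * real n ^ 2) ^ (2 * (n - 1)) * T" if "j < n" for j
  proof -
    define S where "S = {..<n} - {j}"
    define c where "c i = (\<Prod>l\<in>S. iexp (w i * h) - iexp (w l * h))" for i
    have S: "finite S" "card S = n - 1" using that by (auto simp: S_def)
    have c0: "c i = 0" if "i < n" "i \<noteq> j" for i
      using that S by (auto simp: c_def S_def intro!: prod_zero)
    have "(1 / (2 * real n ^ 2)) ^ (n - 1) \<le> (\<Prod>l\<in>S. cmod (iexp (w j * h) - iexp (w l * h)))"
      unfolding S(2)[symmetric] prod_constant[symmetric]
    proof (rule prod_mono, safe)
      fix l assume "l \<in> S"
      then have l: "l < n" "l \<noteq> j" by (auto simp: S_def)
      have eq: "\<bar>w j * h - w l * h\<bar> = \<bar>real j - real l\<bar> / real n ^ 2"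
      proof -
        have "w j * h - w l * h = (real j - real l) / real n ^ 2"
          by (simp add: w_def h_def power2_eq_square diff_divide_distrib)
        then show ?thesis by (simp add: abs_divide)
      qed
      have 1: "1 \<le> \<bar>real j - real l\<bar>" using l(2) by linarith
      have "\<bar>real j - real l\<bar> \<le> real n" using l(1) that by linarith
      also have "\<dots> \<le> real n ^ 2" using n1 by (simp add: power2_eq_square)
      finally have "\<bar>w j * h - w l * h\<bar> \<le> 1" using assms unfolding eq by simp
      from iexp_diff_lower[OF this] have "\<bar>real j - real l\<bar> / real n ^ 2 / 2 \<le> cmod (iexp (w j * h) - iexp (w l * h))"
        unfolding eq .
      moreover have "1 / (2 * real n ^ 2) \<le> \<bar>real j - real l\<bar> / real n ^ 2 / 2"
        using 1 assms by (simp add: field_simps)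
      ultimately show "1 / (2 * real n ^ 2) \<le> cmod (iexp (w j * h) - iexp (w l * h))" by linarith
    qed simp
    then have cj: "(1 / (2 * real n ^ 2)) ^ (n - 1) \<le> cmod (c j)" by (simp add: c_def prod_norm)
    have "(g j)\<^sup>2 * ((1 / (2 * real n ^ 2)) ^ (n - 1))\<^sup>2 \<le> (g j)\<^sup>2 * (cmod (c j))\<^sup>2"
      using cj by (intro mult_left_mono power_mono) auto
    \<comment> \<open>The surviving term has constant modulus and the interval has length 1, so the
      integral is just that modulus squared.\<close>
    also have "\<dots> = integral {-1..0} (\<lambda>u. (cmod (\<Sum>i<n. g i * c i * iexp (w i * u)))\<^sup>2)"
    proof -
      have "(\<Sum>i<n. g i * c i * iexp (w i * u)) = g j * c j * iexp (w j * u)" for u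
        using that c0 by (subst sum.remove[of _ j]) (auto intro!: sum.neutral)
      then show ?thesis by (simp add: norm_mult power_mult_distrib)
    qed
    also have "\<dots> \<le> 4 ^ card S * integral {-1..0 + card S * h} (\<lambda>u. (cmod (\<Sum>i<n. g i * iexp (w i * u)))\<^sup>2)"
      unfolding c_def using S by (intro difference_operator_bound) (auto simp: h_def)
    also have "integral {-1..0 + card S * h} (\<lambda>u. (cmod (\<Sum>i<n. g i * iexp (w i * u)))\<^sup>2) \<le> T"
      unfolding T_def S(2) using assms
      by (intro integral_subset_le integrable_continuous_interval continuous_intros) (auto simp: h_def field_simps)
    finally have "(g j)\<^sup>2 * ((1 / (2 * real n ^ 2)) ^ (n - 1))\<^sup>2 \<le> 4 ^ (n - 1) * T" by (simp add: S)
    \<comment> \<open>In this form the numerator cancels the factor 4^(n - 1) lost by the difference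
      operators.\<close>
    moreover have "((1 / (2 * real n ^ 2)) ^ (n - 1))\<^sup>2 = 4 ^ (n - 1) / (4 * real n ^ 2) ^ (2 * (n - 1))"
    proof -
      have "(1 / (2 * real n ^ 2))\<^sup>2 = 4 / (4 * real n ^ 2)\<^sup>2"
        by (simp add: power2_eq_square)
      then have "((1 / (2 * real n ^ 2))\<^sup>2) ^ (n - 1) = 4 ^ (n - 1) / ((4 * real n ^ 2)\<^sup>2) ^ (n - 1)"
        by (simp only: power_divide)
      then show ?thesis by (simp only: power_mult[symmetric] mult.commute[of "n - 1"])
    qed
    ultimately show ?thesis using assms by (simp add: field_simps)
  qed
  have "(\<Sum>j<n. (g j)\<^sup>2) \<le> (\<Sum>j<n. (4 * real n ^ 2) ^ (2 * (n - 1)) * T)"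
    using gj by (intro sum_mono) auto
  also have "\<dots> = (4 * real n ^ 2) ^ (2 * (n - 1)) * n * T" by simp
  also have "\<dots> \<le> (4 * real n ^ 2) ^ (2 * (n - 1)) * (4 * real n ^ 2) ^ 2 * T"
  proof (intro mult_right_mono mult_left_mono \<open>0 \<le> T\<close>)
    have "real n * 1 \<le> real n * (16 * real n ^ 3)"
      using n1 one_le_power[OF n1, of 3] by (intro mult_left_mono) linarith+
    then show "real n \<le> (4 * real n ^ 2) ^ 2" by (simp add: power_mult_distrib eval_nat_numeral)
  qed auto
  also have "(4 * real n ^ 2) ^ (2 * (n - 1)) * (4 * real n ^ 2) ^ 2 = (4 * real n ^ 2) ^ (2 * n)"
    using assms by (cases n) (simp_all add: power_add[symmetric])
  finally show ?thesis by (simp add: T_def w_def)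
qed

lemma cmod_exponential_sum_square:
  fixes g t :: "'i \<Rightarrow> real"
  shows "(cmod (\<Sum>i\<in>I. g i * iexp (t i * u)))\<^sup>2 = (\<Sum>i\<in>I. \<Sum>j\<in>I. g i * g j * cos ((t i - t j) * u))"
proof -
  have "(cmod (\<Sum>i\<in>I. g i * iexp (t i * u)))\<^sup>2 =
        (\<Sum>i\<in>I. g i * cos (t i * u))\<^sup>2 + (\<Sum>i\<in>I. g i * sin (t i * u))\<^sup>2"
    by (simp add: cmod_power2 Re_exp Im_exp)
  also have "\<dots> = (\<Sum>i\<in>I. \<Sum>j\<in>I. g i * g j * cos ((t i - t j) * u))"
    by (simp add: power2_eq_square sum_product left_diff_distrib cos_diff algebra_simps sum.distrib)
  finally show ?thesis .
qed

text \<open>The interval is a full period of length 2 pi n of all frequency differences (i - j) / n,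
  so the off-diagonal cosines integrate to sines at integer multiples of pi.\<close>

lemma exponential_sum_orthogonality:
  fixes g :: "nat \<Rightarrow> real" and n :: nat
  assumes "0 < n"
  shows "integral {- (pi * n)..pi * n} (\<lambda>u. (cmod (\<Sum>j<n. g j * iexp (real j / n * u)))\<^sup>2) = 2 * pi * n * (\<Sum>j<n. (g j)\<^sup>2)"
proof -
  have cos: "((\<lambda>u. g i * g j * cos ((real i / n - real j / n) * u)) has_integral (if i = j then (g i)\<^sup>2 * (2 * pi * n) else 0))
      {- (pi * n)..pi * n}" for i j
  proof (cases "i = j")
    case True
    have "((\<lambda>u. (g i)\<^sup>2) has_integral (2 * pi * n) * (g i)\<^sup>2) {- (pi * n)..pi * n}"
      using has_integral_const_real[of "(g i)\<^sup>2" "- (pi * n)" "pi * n"] by (simp add: mult.assoc)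
    then show ?thesis using True by (simp add: power2_eq_square mult_ac)
  next
    case False
    define c where "c = (real i - real j) / n"
    have c: "c \<noteq> 0" using False assms by (simp add: c_def)
    have "((\<lambda>u. cos (c * u)) has_integral (sin (c * (pi * n)) / c - sin (c * - (pi * n)) / c)) {- (pi * n)..pi * n}"
      using c by (intro fundamental_theorem_of_calculus)
        (auto intro!: derivative_eq_intros simp flip: has_real_derivative_iff_has_vector_derivative)
    moreover have "sin (c * (pi * n)) = 0"
      using sin_integer_2pi sin_npi_int[of "int i - int j"] assms by (simp add: c_def mult.commute)
    ultimately have "((\<lambda>u. cos (c * u)) has_integral 0) {- (pi * n)..pi * n}" by simp
    from has_integral_mult_right[OF this, of "g i * g j"] show ?thesis
      using False by (simp add: c_def diff_divide_distrib)
  qed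
  have "((\<lambda>u. \<Sum>i<n. \<Sum>j<n. g i * g j * cos ((real i / n - real j / n) * u)) has_integral
        (\<Sum>i<n. \<Sum>j<n. if i = j then (g i)\<^sup>2 * (2 * pi * n) else 0)) {- (pi * n)..pi * n}"
    by (intro has_integral_sum cos) auto
  then show ?thesis
    unfolding cmod_exponential_sum_square
    by (simp add: integral_unique sum_distrib_left mult_ac)
qed

section \<open>From lower bounds on the variance form to lower bounds on
  \<open>small_ball\<close>\<close>

context spectral_gaussian
begin

lemma covar_form_ge_integral:
  fixes g :: "'i \<Rightarrow> real"
  assumes "0 \<le> c" and "\<And>u. \<bar>u\<bar> \<le> R \<Longrightarrow> c \<le> f u"
  shows "c * integral {-R..R} (\<lambda>u. (cmod (\<Sum>i\<in>I. g i * iexp (t i * u)))\<^sup>2) \<le> covar_form I t g"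
proof -
  define q where "q u = (cmod (\<Sum>i\<in>I. g i * iexp (t i * u)))\<^sup>2" for u
  have cont: "continuous_on A q" for A unfolding q_def by (intro continuous_intros)
  have int: "set_integrable lborel {-R..R} q"
    unfolding set_integrable_def by (intro borel_integrable_compact cont) auto
  have "c * integral {-R..R} q = c * (LINT u:{-R..R}|lborel. q u)"
    using set_borel_integral_eq_integral(2)[OF int] by simp
  also have "\<dots> = (\<integral>u. c * (indicator {-R..R} u * q u) \<partial>lborel)"
    by (simp add: set_lebesgue_integral_def)
  also have "\<dots> \<le> (\<integral>u. f u * q u \<partial>lborel)"
  proof (rule integral_mono)
    show "integrable lborel (\<lambda>u. c * (indicator {-R..R} u * q u))"
      using int by (simp add: set_integrable_def)
    show "integrable lborel (\<lambda>u. f u * q u)" unfolding q_def by (rule covar_integrable)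
    show "c * (indicator {-R..R} u * q u) \<le> f u * q u" for u
      using assms(2)[of u] f_nonneg[of u] by (auto simp: q_def indicator_def intro!: mult_right_mono)
  qed
  finally show ?thesis unfolding q_def covar_form_def .
qed

text \<open>Continuous paths are bounded on the compact unit interval, so the \<open>SUP\<close> in
  \<open>small_ball\<close> is a genuine supremum.\<close>

lemma bdd_above_path: "\<omega> \<in> space M \<Longrightarrow> bdd_above ((\<lambda>t. \<bar>X t \<omega>\<bar>) ` {0..1})"
proof -
  assume "\<omega> \<in> space M"
  then have "continuous_on {0..1} (\<lambda>t. X t \<omega>)"
    using continuous continuous_on_subset by (fastforce simp: continuous_paths_def)
  then have "compact ((\<lambda>t. \<bar>X t \<omega>\<bar>) ` {0..1})"
    by (intro compact_continuous_image continuous_on_rabs) auto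
  then show ?thesis by (intro bounded_imp_bdd_above compact_imp_bounded)
qed

lemma sup_le_iff:
  assumes "\<omega> \<in> space M"
  shows "(SUP t\<in>{0..1}. \<bar>X t \<omega>\<bar>) \<le> r \<longleftrightarrow> (\<forall>t\<in>{0..1}. \<bar>X t \<omega>\<bar> \<le> r)"
  by (rule cSUP_le_iff) (simp_all add: bdd_above_path[OF assms])

text \<open>The supremum is written pointwise, so that passing to finitely many times is an
  inclusion of events.\<close>

definition ball_prob :: "real \<Rightarrow> real" where
  "ball_prob r = prob {\<omega> \<in> space M. \<forall>t\<in>{0..1}. \<bar>X t \<omega>\<bar> \<le> r}"

lemma small_ball_eq: "small_ball M X r = - ln (ball_prob r)"
proof -
  have "{\<omega> \<in> space M. (SUP t\<in>{0..1}. \<bar>X t \<omega>\<bar>) \<le> r} = {\<omega> \<in> space M. \<forall>t\<in>{0..1}. \<bar>X t \<omega>\<bar> \<le> r}"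
    using sup_le_iff by auto
  then show ?thesis by (simp add: small_ball_def ball_prob_def)
qed

text \<open>Logarithm of \<open>prob_cube_le\<close> after the summand 1 in 1 + l / r^2 is dropped.
  Positivity of \<open>ball_prob r\<close> makes the logarithms comparable; it will be supplied by
  the bound in the opposite direction.\<close>

lemma small_ball_ge:
  assumes "finite I" "0 < l" "0 < r" "0 < ball_prob r" "\<And>i. i \<in> I \<Longrightarrow> t i \<in> {0..1}"
    and V: "\<And>g. l * (\<Sum>i\<in>I. (g i)\<^sup>2) \<le> covar_form I t g"
  shows "card I * (- ln r + ln l / 2 - 1 / 2) \<le> small_ball M X r"
proof -
  have "ball_prob r \<le> prob {\<omega> \<in> space M. \<forall>i\<in>I. \<bar>X (t i) \<omega>\<bar> \<le> r}"
    unfolding ball_prob_def using assms(1,5) by (intro finite_measure_mono) auto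
  also have "\<dots> \<le> exp (card I / 2) * (1 + l / r\<^sup>2) powr (- real (card I) / 2)"
    using assms by (intro prob_cube_le) auto
  also have "\<dots> \<le> exp (card I / 2) * (l / r\<^sup>2) powr (- real (card I) / 2)"
    using assms by (intro mult_left_mono powr_mono2') auto
  also have "\<dots> = exp (- (card I * (- ln r + ln l / 2 - 1 / 2)))"
    using assms by (simp add: powr_def ln_div ln_realpow field_simps flip: exp_add)
  finally have "ln (ball_prob r) \<le> - (card I * (- ln r + ln l / 2 - 1 / 2))"
    using assms(4) by (simp add: ln_ge_iff[symmetric] ln_le_cancel_iff[symmetric] del: ln_le_cancel_iff)
  then show ?thesis by (simp add: small_ball_eq)
qed

lemma small_ball_ge_flat:
  assumes "0 < c" "\<And>u. \<bar>u\<bar> \<le> 1 \<Longrightarrow> c \<le> f u" "0 < n" "0 < r" "0 < ball_prob r"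
  shows "real n * (- ln r + ln c / 2 - real n * ln (4 * real n ^ 2) - 1 / 2) \<le> small_ball M X r"
proof -
  \<comment> \<open>The density bound on [-1, 1] divided by the loss in isolating coefficients; half
    of its logarithm produces the term n ln (4 n^2).\<close>
  define l where "l = c / (4 * real n ^ 2) ^ (2 * n)"
  have "real (card {..<n}) * (- ln r + ln l / 2 - 1 / 2) \<le> small_ball M X r"
  proof (rule small_ball_ge[where t="\<lambda>j. real j / n"])
    fix g :: "nat \<Rightarrow> real"
    define T where "T = integral {-1..1} (\<lambda>u. (cmod (\<Sum>j<n. g j * iexp (real j / n * u)))\<^sup>2)"
    have "l * (\<Sum>j<n. (g j)\<^sup>2) \<le> l * ((4 * real n ^ 2) ^ (2 * n) * T)"
      using exponential_sum_coefficient_bound[OF \<open>0 < n\<close>, of g] assms(1)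
      by (intro mult_left_mono) (auto simp: T_def l_def)
    also have "\<dots> = c * T" using assms by (simp add: l_def)
    also have "\<dots> \<le> covar_form {..<n} (\<lambda>j. real j / n) g"
      unfolding T_def using assms by (intro covar_form_ge_integral) auto
    finally show "l * (\<Sum>j<n. (g j)\<^sup>2) \<le> covar_form {..<n} (\<lambda>j. real j / n) g" .
  qed (use assms in \<open>auto simp: l_def\<close>)
  moreover have "ln l = ln c - 2 * n * ln (4 * real n ^ 2)"
    using assms ln_realpow[of "4 * real n ^ 2" "2 * n"]
    by (simp add: l_def ln_div del: power_mult_distrib)
  ultimately show ?thesis by (simp add: algebra_simps)
qed

lemma small_ball_ge_stretched:
  assumes "0 < \<alpha>" "\<And>u. exp (- (\<bar>u\<bar> powr \<alpha>)) \<le> f u" "0 < n" "0 < r" "0 < ball_prob r"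
  shows "real n * (- ln r - (pi * n) powr \<alpha> / 2 - 1 / 2) \<le> small_ball M X r"
proof -
  define l where "l = exp (- ((pi * n) powr \<alpha>))"
  have "real (card {..<n}) * (- ln r + ln l / 2 - 1 / 2) \<le> small_ball M X r"
  proof (rule small_ball_ge[where t="\<lambda>j. real j / n"])
    fix g :: "nat \<Rightarrow> real"
    have "1 * 1 \<le> pi * real n" using assms(3) pi_ge_two by (intro mult_mono) auto
    then have "l * (1 * (\<Sum>j<n. (g j)\<^sup>2)) \<le> l * ((2 * pi * n) * (\<Sum>j<n. (g j)\<^sup>2))"
      by (intro mult_left_mono mult_right_mono) (auto simp: l_def intro!: sum_nonneg)
    also have "\<dots> = l * integral {- (pi * n)..pi * n} (\<lambda>u. (cmod (\<Sum>j<n. g j * iexp (real j / n * u)))\<^sup>2)"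
      using exponential_sum_orthogonality[OF assms(3), of g] by simp
    also have "\<dots> \<le> covar_form {..<n} (\<lambda>j. real j / n) g"
    proof (intro covar_form_ge_integral)
      fix u assume "\<bar>u\<bar> \<le> pi * n"
      then have "\<bar>u\<bar> powr \<alpha> \<le> (pi * n) powr \<alpha>" using assms(1) by (intro powr_mono2) auto
      then show "l \<le> f u" using assms(2)[of u] unfolding l_def by (meson exp_le_cancel_iff neg_le_iff_le order_trans)
    qed (simp add: l_def)
    finally show "l * (\<Sum>j<n. (g j)\<^sup>2) \<le> covar_form {..<n} (\<lambda>j. real j / n) g" by simp
  qed (use assms in \<open>auto simp: l_def\<close>)
  then show ?thesis by (simp add: l_def)
qed

end

section \<open>Chaining and piecewise Taylor expansion\<close>

text \<open>The dyadic floors of \<open>t\<close> converge to \<open>t\<close> from below and stay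
  in the unit interval, so continuity carries the bound to the limit.\<close>

lemma dyadic_le_imp_le:
  fixes g :: "real \<Rightarrow> real"
  assumes "continuous_on UNIV g" "t \<in> {0..1}"
    and le: "\<And>j i. i \<le> 2 ^ (K + j) \<Longrightarrow> g (real i / 2 ^ (K + j)) \<le> r"
  shows "g t \<le> r"
proof -
  define s where "s j = real (nat \<lfloor>2 ^ (K + j) * t\<rfloor>) / 2 ^ (K + j)" for j
  have s: "t - (1 / 2) ^ j \<le> s j" "s j \<le> t" "g (s j) \<le> r" for j
  proof -
    have nn: "0 \<le> 2 ^ (K + j) * t" using assms(2) by simp
    then have eq: "real (nat \<lfloor>2 ^ (K + j) * t\<rfloor>) = of_int \<lfloor>2 ^ (K + j) * t\<rfloor>" by simp
    have "2 ^ (K + j) * t - 1 \<le> real (nat \<lfloor>2 ^ (K + j) * t\<rfloor>)" unfolding eq by linarith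
    then have "(2 ^ (K + j) * t - 1) / 2 ^ (K + j) \<le> s j"
      unfolding s_def by (intro divide_right_mono) auto
    then have "t - (1 / 2) ^ (K + j) \<le> s j"
      by (simp add: diff_divide_distrib power_divide)
    moreover have "(1 / 2 :: real) ^ (K + j) \<le> (1 / 2) ^ j" by (intro power_decreasing) auto
    ultimately show "t - (1 / 2) ^ j \<le> s j" by linarith
    have "real (nat \<lfloor>2 ^ (K + j) * t\<rfloor>) \<le> 2 ^ (K + j) * t" unfolding eq by linarith
    then show "s j \<le> t" by (simp add: s_def field_simps)
    have "2 ^ (K + j) * t \<le> 2 ^ (K + j) * 1" using assms(2) by (intro mult_left_mono) auto
    then have "real (nat \<lfloor>2 ^ (K + j) * t\<rfloor>) \<le> 2 ^ (K + j)" unfolding eq by linarith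
    then have "real (nat \<lfloor>2 ^ (K + j) * t\<rfloor>) \<le> real (2 ^ (K + j))" by simp
    then have "nat \<lfloor>2 ^ (K + j) * t\<rfloor> \<le> 2 ^ (K + j)" by (simp only: of_nat_le_iff)
    then show "g (s j) \<le> r" unfolding s_def by (rule le)
  qed
  have "(\<lambda>j. t - (1 / 2) ^ j) \<longlonglongrightarrow> t - 0"
    by (intro tendsto_intros LIMSEQ_realpow_zero) auto
  then have "s \<longlonglongrightarrow> t"
    by (intro real_tendsto_sandwich[of "\<lambda>j. t - (1 / 2) ^ j" s _ "\<lambda>_. t"]) (auto simp: s)
  then have "(\<lambda>j. g (s j)) \<longlonglongrightarrow> g t"
    using assms(1) by (auto simp: continuous_on_eq_continuous_at intro: isCont_tendsto_compose)
  then show ?thesis by (rule LIMSEQ_le_const2) (use s in auto)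
qed

text \<open>An even index at level j + 1 is already a point of level j; an odd one is a single
  increment away from its left neighbour, which has even index.\<close>

lemma dyadic_chaining:
  fixes g :: "real \<Rightarrow> real"
  assumes "0 \<le> r"
    and coarse: "\<And>i. i \<le> 2 ^ K \<Longrightarrow> \<bar>g (real i / 2 ^ K)\<bar> \<le> r / 2"
    and incr: "\<And>j i. i < 2 ^ (K + Suc j) \<Longrightarrow>
       \<bar>g (real (Suc i) / 2 ^ (K + Suc j)) - g (real i / 2 ^ (K + Suc j))\<bar> \<le> r / 4 * (2 / 3) ^ Suc j"
    and "i \<le> 2 ^ (K + j)"
  shows "\<bar>g (real i / 2 ^ (K + j))\<bar> \<le> r"
proof -
  \<comment> \<open>The strengthened bound equals r / 2 at j = 0, and its growth from j to j + 1 is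
    r / 6 times (2 / 3)^j, exactly the permitted increment.\<close>
  have "\<bar>g (real i / 2 ^ (K + j))\<bar> \<le> r - r / 2 * (2 / 3) ^ j"
    using assms(4)
  proof (induction j arbitrary: i)
    case 0
    then show ?case using coarse by simp
  next
    case (Suc j)
    have mono: "r / 2 * (2 / 3) ^ Suc j \<le> r / 2 * (2 / 3) ^ j" using assms(1) by simp
    show ?case
    proof (cases "even i")
      case True
      then obtain l where l: "i = 2 * l" by blast
      have "real i / 2 ^ (K + Suc j) = real l / 2 ^ (K + j)" by (simp add: l)
      moreover have "l \<le> 2 ^ (K + j)" using Suc.prems by (simp add: l)
      ultimately show ?thesis using Suc.IH[of l] mono by simp
    next
      case False
      then obtain l where l: "i = Suc (2 * l)" by (auto elim: oddE)
      have eq: "real (2 * l) / 2 ^ (K + Suc j) = real l / 2 ^ (K + j)" by simp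
      have "2 * l < 2 ^ (K + Suc j)" "l \<le> 2 ^ (K + j)" using Suc.prems by (simp_all add: l)
      then have "\<bar>g (real i / 2 ^ (K + Suc j)) - g (real l / 2 ^ (K + j))\<bar> \<le> r / 4 * (2 / 3) ^ Suc j"
        and "\<bar>g (real l / 2 ^ (K + j))\<bar> \<le> r - r / 2 * (2 / 3) ^ j"
        using incr[of "2 * l" j] Suc.IH[of l] unfolding eq l by auto
      moreover have "r / 4 * (2 / 3) ^ Suc j = r * (2 / 3) ^ j / 6" "r / 2 * (2 / 3) ^ Suc j = r * (2 / 3) ^ j / 3"
        "r / 2 * (2 / 3) ^ j = r * (2 / 3) ^ j / 2" by simp_all
      ultimately show ?thesis by linarith
    qed
  qed
  also have "\<dots> \<le> r" using assms(1) by simp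
  finally show ?thesis .
qed

lemma iexp_remainder:
  assumes "0 < m"
  shows "cmod (iexp x - (\<Sum>k<m. (\<i> * x) ^ k / fact k)) \<le> \<bar>x\<bar> ^ m / fact m"
proof -
  obtain m' where "m = Suc m'" using assms by (cases m) auto
  then show ?thesis using iexp_approx1[of x m'] by (simp add: lessThan_Suc_atMost)
qed

lemma sum_bound_square:
  fixes x y :: real
  assumes "0 \<le> z" "z \<le> (\<Sum>p\<in>P. a p) + (\<Sum>i\<in>I. b i)"
  shows "z\<^sup>2 \<le> 2 * real (card P) * (\<Sum>p\<in>P. (a p)\<^sup>2) + 2 * real (card I) * (\<Sum>i\<in>I. (b i)\<^sup>2)"
proof -
  have "z\<^sup>2 \<le> ((\<Sum>p\<in>P. a p) + (\<Sum>i\<in>I. b i))\<^sup>2" using assms by (intro power_mono)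
  also have "\<dots> \<le> 2 * (\<Sum>p\<in>P. a p)\<^sup>2 + 2 * (\<Sum>i\<in>I. b i)\<^sup>2"
    using sum_squares_bound[of "\<Sum>p\<in>P. a p" "\<Sum>i\<in>I. b i"] by (simp add: power2_sum)
  also have "\<dots> \<le> 2 * ((\<Sum>p\<in>P. (a p)\<^sup>2) * card P) + 2 * ((\<Sum>i\<in>I. (b i)\<^sup>2) * card I)"
    by (intro add_mono mult_left_mono sum_squared_le_sum_of_squares) auto
  finally show ?thesis by (simp add: mult_ac)
qed

section \<open>Chaining and Taylor expansion under finite spectral moments\<close>

locale smooth_spectral_gaussian = spectral_gaussian +
  assumes moments: "integrable lborel (\<lambda>u. f u * u ^ (2 * k))"
begin

text \<open>The spectral moment of order 2 k: squared Taylor terms of degree k in u integrate to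
  multiples of it, and \<open>moment 1\<close> controls the increments.\<close>

definition moment :: "nat \<Rightarrow> real" where
  "moment k = (\<integral>u. f u * u ^ (2 * k) \<partial>lborel)"

lemma moment_nonneg: "0 \<le> moment k"
  unfolding moment_def by (intro integral_nonneg_AE AE_I2 mult_nonneg_nonneg f_nonneg) simp

lemma increment_variance:
  "(\<integral>\<omega>. (X s \<omega> - X t \<omega>)\<^sup>2 \<partial>M) \<le> moment 1 * (s - t)\<^sup>2"
proof -
  \<comment> \<open>Booleans index the two-term combination X s - X t, so the general variance
    formula applies even if s = t.\<close>
  let ?t = "\<lambda>b. if b then s else t" and ?g = "\<lambda>b. if b then 1 else - 1 :: real"
  have "(\<integral>\<omega>. (X s \<omega> - X t \<omega>)\<^sup>2 \<partial>M) = covar_form UNIV ?t ?g"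
    using lin_variance[of UNIV ?g ?t] by (simp add: UNIV_bool)
  also have "\<dots> \<le> (\<integral>u. (s - t)\<^sup>2 * (f u * u ^ (2 * 1)) \<partial>lborel)"
    unfolding covar_form_def
  proof (rule integral_mono[OF covar_integrable])
    show "integrable lborel (\<lambda>u. (s - t)\<^sup>2 * (f u * u ^ (2 * 1)))"
      by (intro integrable_mult_right moments)
    fix u
    have "iexp (s * u) - iexp (t * u) = iexp (t * u) * (iexp ((s - t) * u) - 1)"
      by (simp add: algebra_simps flip: exp_add)
    then have "cmod (iexp (s * u) - iexp (t * u)) = cmod (iexp ((s - t) * u) - 1)"
      by (simp add: norm_mult)
    also have "\<dots> \<le> \<bar>(s - t) * u\<bar>"
      using iexp_approx1[of "(s - t) * u" 0] by simp
    finally have "(cmod (iexp (s * u) - iexp (t * u)))\<^sup>2 \<le> \<bar>(s - t) * u\<bar>\<^sup>2"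
      by (intro power_mono) auto
    from mult_left_mono[OF this f_nonneg]
    show "f u * (cmod (\<Sum>b\<in>UNIV. ?g b * iexp (?t b * u)))\<^sup>2 \<le> (s - t)\<^sup>2 * (f u * u ^ (2 * 1))"
      by (simp add: UNIV_bool power_mult_distrib mult_ac)
  qed
  also have "\<dots> = moment 1 * (s - t)\<^sup>2" by (simp add: moment_def)
  finally show ?thesis .
qed

lemma increment_tail:
  assumes "0 < D" "moment 1 \<le> D" "0 < x" "s \<noteq> t"
  shows "prob {\<omega> \<in> space M. x < \<bar>X s \<omega> - X t \<omega>\<bar>} \<le> 2 * exp (- (x\<^sup>2 / (4 * (D * (s - t)\<^sup>2))))"
proof (rule gaussian_tail)
  let ?t = "\<lambda>b. if b then s else t" and ?g = "\<lambda>b. if b then 1 else - 1 :: real"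
  show "gaussian_law (distr M borel (\<lambda>\<omega>. X s \<omega> - X t \<omega>))"
    using lin_gaussian[of UNIV ?g ?t] by (simp add: UNIV_bool)
  show "(\<integral>\<omega>. X s \<omega> - X t \<omega> \<partial>M) = 0"
    using centered by (simp add: X_integrable centered_process_def)
  show "(\<integral>\<omega>. (X s \<omega> - X t \<omega>)\<^sup>2 \<partial>M) \<le> D * (s - t)\<^sup>2"
    using increment_variance[of s t] assms(2) by (smt (verit) mult_right_mono zero_le_power2)
qed (use assms prob_space_axioms in auto)

text \<open>A union bound over levels. At level j + 1 the tail exponent is y (16 / 9)^(j + 1),
  because thresholds squared shrink by 4 / 9 while variances shrink by 1 / 4. Since y is at least 3,
  each tail is at most 2 exp (- y) / 4^(j + 1), which beats the 2^(K + j + 1) increments and leaves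
  a geometric series of sum 1.\<close>

lemma prob_chaining_fails:
  assumes "0 < D" "moment 1 \<le> D" "0 < r" and y: "y = r\<^sup>2 * 4 ^ K / (64 * D)" "3 \<le> y"
  shows "prob (\<Union>j. \<Union>i<2 ^ (K + Suc j). {\<omega> \<in> space M. r / 4 * (2 / 3) ^ Suc j <
            \<bar>X (real (Suc i) / 2 ^ (K + Suc j)) \<omega> - X (real i / 2 ^ (K + Suc j)) \<omega>\<bar>})
         \<le> 2 * 2 ^ K * exp (- y)"
proof -
  define B where "B j i = {\<omega> \<in> space M. r / 4 * (2 / 3) ^ Suc j <
            \<bar>X (real (Suc i) / 2 ^ (K + Suc j)) \<omega> - X (real i / 2 ^ (K + Suc j)) \<omega>\<bar>}" for j i
  have B[measurable]: "B j i \<in> events" for i j unfolding B_def by measurable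
  have Bij: "prob (B j i) \<le> 2 * (exp (- y) * (1 / 4) ^ Suc j)" for j i
  proof -
    define d where "d = real (Suc i) / 2 ^ (K + Suc j) - real i / 2 ^ (K + Suc j)"
    have d: "d = 1 / 2 ^ (K + Suc j)" by (simp add: d_def flip: diff_divide_distrib)
    have "prob (B j i) \<le> 2 * exp (- ((r / 4 * (2 / 3) ^ Suc j)\<^sup>2 / (4 * (D * d\<^sup>2))))"
      unfolding B_def d_def using assms by (intro increment_tail) (auto simp: field_simps)
    also have "(r / 4 * (2 / 3) ^ Suc j)\<^sup>2 / (4 * (D * d\<^sup>2)) = y * (16 / 9) ^ Suc j"
    proof -
      have comm: "(x ^ l)\<^sup>2 = (x\<^sup>2) ^ l" for x :: real and l
        by (simp only: power_mult[symmetric] mult.commute)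
      have sq: "((2 / 3 :: real) ^ Suc j)\<^sup>2 = (4 / 9) ^ Suc j" "(2 ^ (K + Suc j) :: real)\<^sup>2 = 4 ^ K * 4 ^ Suc j"
        unfolding comm by (simp_all add: power_divide power_add)
      have "(4 / 9 :: real) ^ Suc j * 4 ^ Suc j = (16 / 9) ^ Suc j"
        by (simp flip: power_mult_distrib)
      then show ?thesis
        using assms(1) sq by (simp add: y(1) d power_divide power_mult_distrib field_simps del: power_Suc)
    qed
    also have "2 * exp (- (y * (16 / 9) ^ Suc j)) \<le> 2 * (exp (- y) * (1 / 4) ^ Suc j)"
    proof -
      \<comment> \<open>Bernoulli gives the excess y (j + 1) 7 / 9 over y, and y at least 3 raises
        it above 2 (j + 1).\<close>
      have "1 + real (Suc j) * (7 / 9) \<le> (1 + 7 / 9) ^ Suc j" by (rule Bernoulli_inequality) simp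
      then have "y * (1 + real (Suc j) * (7 / 9)) \<le> y * (16 / 9) ^ Suc j"
        using y(2) by (intro mult_left_mono) auto
      moreover have "3 * (real (Suc j) * (7 / 9)) \<le> y * (real (Suc j) * (7 / 9))"
        using y(2) by (intro mult_right_mono) auto
      moreover have "2 * real (Suc j) \<le> 3 * (real (Suc j) * (7 / 9))" by simp
      ultimately have "y + 2 * real (Suc j) \<le> y * (16 / 9) ^ Suc j"
        unfolding distrib_left mult_1_right by linarith
      then have "exp (- (y * (16 / 9) ^ Suc j)) \<le> exp (- y + real (Suc j) * (- 2))" by simp
      also have "\<dots> = exp (- y) * (exp (- 2)) ^ Suc j" by (simp only: exp_add exp_of_nat_mult)
      also have "\<dots> \<le> exp (- y) * (1 / 4) ^ Suc j"
      proof (intro mult_left_mono power_mono)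
        have "(2::real) * 2 \<le> exp 1 * exp 1"
          using exp_ge_add_one_self[of 1] by (intro mult_mono) auto
        then have "4 \<le> exp (2::real)" by (simp flip: exp_add)
        then show "exp (- 2 :: real) \<le> 1 / 4" by (simp add: exp_minus field_simps)
      qed auto
      finally show ?thesis by simp
    qed
    finally show ?thesis .
  qed
  have Uj: "prob (\<Union>i<2 ^ (K + Suc j). B j i) \<le> 2 * 2 ^ K * exp (- y) * (1 / 2) ^ Suc j" for j
  proof -
    have "prob (\<Union>i<2 ^ (K + Suc j). B j i) \<le> (\<Sum>i<2 ^ (K + Suc j). prob (B j i))"
      by (intro measure_UNION_le) auto
    also have "\<dots> \<le> (\<Sum>i<(2::nat) ^ (K + Suc j). 2 * (exp (- y) * (1 / 4) ^ Suc j))"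
      by (intro sum_mono Bij)
    also have "\<dots> = 2 * 2 ^ K * exp (- y) * (2 ^ Suc j * (1 / 4) ^ Suc j)"
      by (simp add: power_add)
    also have "(2 ^ Suc j * (1 / 4) ^ Suc j :: real) = (1 / 2) ^ Suc j"
      by (simp only: power_mult_distrib[symmetric]) simp
    finally show ?thesis .
  qed
  have geo: "(\<lambda>j. 2 * 2 ^ K * exp (- y) * (1 / 2) ^ Suc j) sums (2 * 2 ^ K * exp (- y) * 1)"
    by (intro sums_mult power_half_series)
  have summ: "summable (\<lambda>j. prob (\<Union>i<2 ^ (K + Suc j). B j i))"
    by (rule summable_comparison_test'[OF sums_summable[OF geo], of 0]) (use Uj in auto)
  have "prob (\<Union>j. \<Union>i<2 ^ (K + Suc j). B j i) \<le> (\<Sum>j. prob (\<Union>i<2 ^ (K + Suc j). B j i))"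
    by (intro finite_measure_subadditive_countably summ) auto
  also have "\<dots> \<le> (\<Sum>j. 2 * 2 ^ K * exp (- y) * (1 / 2) ^ Suc j)"
    by (intro suminf_le Uj summ sums_summable[OF geo])
  also have "\<dots> = 2 * 2 ^ K * exp (- y)" by (simp only: sums_unique[OF geo, symmetric] mult_1_right)
  finally show ?thesis by (simp only: B_def)
qed

text \<open>Path continuity replaces the uncountably many constraints by those at dyadic times,
  hence by a countable intersection.\<close>

lemma ball_event: "{\<omega> \<in> space M. \<forall>t\<in>{0..1}. \<bar>X t \<omega>\<bar> \<le> r} \<in> events"
proof -
  have "{\<omega> \<in> space M. \<forall>t\<in>{0..1}. \<bar>X t \<omega>\<bar> \<le> r} =
        {\<omega> \<in> space M. \<forall>j. \<forall>i\<in>{..2 ^ (0 + j)}. \<bar>X (real i / 2 ^ (0 + j)) \<omega>\<bar> \<le> r}" (is "?A = ?B")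
  proof
    show "?A \<subseteq> ?B" by (auto simp: divide_le_eq_1)
    show "?B \<subseteq> ?A"
    proof safe
      fix \<omega> t assume *: "\<omega> \<in> space M" "\<forall>j. \<forall>i\<in>{..2 ^ (0 + j)}. \<bar>X (real i / 2 ^ (0 + j)) \<omega>\<bar> \<le> r" "t \<in> {0..1::real}"
      show "\<bar>X t \<omega>\<bar> \<le> r"
      proof (rule dyadic_le_imp_le[where K=0 and g="\<lambda>t. \<bar>X t \<omega>\<bar>"])
        show "continuous_on UNIV (\<lambda>t. \<bar>X t \<omega>\<bar>)"
          using continuous *(1) by (auto simp: continuous_paths_def intro!: continuous_on_rabs)
        show "\<bar>X (real i / 2 ^ (0 + j)) \<omega>\<bar> \<le> r" if "i \<le> 2 ^ (0 + j)" for i j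
          using *(2) that by blast
      qed fact
    qed
  qed
  also have "?B \<in> events" by measurable
  finally show ?thesis .
qed

text \<open>The radius is shared: r / 2 for the grid points and r / 2 for all finer increments.
  Outside the failure event \<open>U\<close> chaining bounds every dyadic value by r.\<close>

lemma ball_prob_ge_grid:
  assumes "0 < D" "moment 1 \<le> D" "0 < r" and y: "y = r\<^sup>2 * 4 ^ K / (64 * D)" "3 \<le> y"
  shows "prob {\<omega> \<in> space M. \<forall>i\<in>{..2 ^ K}. \<bar>X (real i / 2 ^ K) \<omega>\<bar> \<le> r / 2} - 2 * 2 ^ K * exp (- y) \<le> ball_prob r"
proof -
  define U where "U = (\<Union>j. \<Union>i<2 ^ (K + Suc j). {\<omega> \<in> space M. r / 4 * (2 / 3) ^ Suc j <
            \<bar>X (real (Suc i) / 2 ^ (K + Suc j)) \<omega> - X (real i / 2 ^ (K + Suc j)) \<omega>\<bar>})"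
  define G where "G = {\<omega> \<in> space M. \<forall>t\<in>{0..1}. \<bar>X t \<omega>\<bar> \<le> r}"
  have U: "U \<in> events" unfolding U_def by measurable
  have G: "G \<in> events" unfolding G_def by (rule ball_event)
  have "{\<omega> \<in> space M. \<forall>i\<in>{..2 ^ K}. \<bar>X (real i / 2 ^ K) \<omega>\<bar> \<le> r / 2} \<subseteq> G \<union> U"
  proof safe
    fix \<omega> assume \<omega>: "\<omega> \<in> space M" and coarse: "\<forall>i\<in>{..2 ^ K}. \<bar>X (real i / 2 ^ K) \<omega>\<bar> \<le> r / 2" and "\<omega> \<notin> U"
    have incr: "\<bar>X (real (Suc i) / 2 ^ (K + Suc j)) \<omega> - X (real i / 2 ^ (K + Suc j)) \<omega>\<bar> \<le> r / 4 * (2 / 3) ^ Suc j"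
      if "i < 2 ^ (K + Suc j)" for i j
      using \<open>\<omega> \<notin> U\<close> \<omega> that unfolding U_def by (force simp: not_less)
    have "\<bar>X t \<omega>\<bar> \<le> r" if "t \<in> {0..1}" for t
    proof (rule dyadic_le_imp_le[where K=K and g="\<lambda>t. \<bar>X t \<omega>\<bar>"])
      show "continuous_on UNIV (\<lambda>t. \<bar>X t \<omega>\<bar>)"
        using continuous \<omega> by (auto simp: continuous_paths_def intro!: continuous_on_rabs)
      show "\<bar>X (real i / 2 ^ (K + j)) \<omega>\<bar> \<le> r" if "i \<le> 2 ^ (K + j)" for i j
        using dyadic_chaining[of r K "\<lambda>t. X t \<omega>" i j] coarse incr that \<open>0 < r\<close> by auto
    qed fact
    then show "\<omega> \<in> G" using \<omega> by (simp add: G_def)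
  qed
  then have "prob {\<omega> \<in> space M. \<forall>i\<in>{..2 ^ K}. \<bar>X (real i / 2 ^ K) \<omega>\<bar> \<le> r / 2} \<le> prob (G \<union> U)"
    using U G by (intro finite_measure_mono) auto
  also have "\<dots> \<le> prob G + prob U" by (rule measure_Un_le[OF G U])
  also have "prob U \<le> 2 * 2 ^ K * exp (- y)"
    unfolding U_def by (rule prob_chaining_fails) fact+
  finally show ?thesis by (simp add: ball_prob_def G_def)
qed

text \<open>Write t i = (q i + a i) / Q with a i in [0, 1]. Then exp (i t u) is the phase at the
  left endpoint times exp (i a u / Q), which is expanded to degree below m. The pairs (cell, degree)
  index the rank-\<open>n\<close> part. Cauchy-Schwarz over them costs 2 n, and over the remainders
  2 \<open>card I\<close>; integrating against \<open>f\<close> turns the powers of u into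
  moments.\<close>

lemma covar_form_piecewise_taylor:
  fixes t :: "'i \<Rightarrow> real" and Q m :: nat and B \<beta> :: real
  assumes "finite I" "0 < Q" "0 < m" and t: "\<And>i. i \<in> I \<Longrightarrow> t i \<in> {0..1}"
    and B: "\<And>k. k < m \<Longrightarrow> moment k / (fact k * real Q ^ k)\<^sup>2 \<le> B"
    and \<beta>: "moment m / (fact m * real Q ^ m)\<^sup>2 \<le> \<beta>"
  obtains A :: "nat \<times> nat \<Rightarrow> 'i \<Rightarrow> real" where
    "\<And>g. covar_form I t g \<le> (\<Sum>p\<in>{..Q} \<times> {..<m}. (\<Sum>i\<in>I. A p i * g i)\<^sup>2) + 2 * real (card I) * \<beta> * (\<Sum>i\<in>I. (g i)\<^sup>2)"
    "(\<Sum>i\<in>I. \<Sum>p\<in>{..Q} \<times> {..<m}. (A p i)\<^sup>2) \<le> 2 * real (card I) * ((real Q + 1) * m)\<^sup>2 * B"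
proof -
  define P where "P = {..Q} \<times> {..<m}"
  define n where "n = (real Q + 1) * m"
  \<comment> \<open>The time 1 falls into cell Q with offset 0, so the cells are 0 to Q and their
    number is Q + 1.\<close>
  define q where "q i = nat \<lfloor>Q * t i\<rfloor>" for i
  define a where "a i = Q * t i - q i" for i
  \<comment> \<open>The time-dependent factor of a Taylor term: an indicator of the cell times a
    power of the offset. The factors depending on u are bounded separately.\<close>
  define c where "c = (\<lambda>(l, k) i. if l = q i then a i ^ k else 0)"
  define \<kappa> where "\<kappa> k = moment k / (fact k * real Q ^ k)\<^sup>2" for k
  \<comment> \<open>The square root stores the Cauchy-Schwarz factor 2 n and the normalised moment,
    so that the squares add up to the main part.\<close>
  define A where "A p i = sqrt (2 * n * \<kappa> (snd p)) * c p i" for p i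
  have P: "finite P" "real (card P) = n" by (simp_all add: P_def n_def algebra_simps)
  have q: "q i \<le> Q" "0 \<le> a i" "a i \<le> 1" if "i \<in> I" for i
  proof -
    have nn: "0 \<le> Q * t i" "Q * t i \<le> Q" using t[OF that] by (auto simp: mult_left_le)
    then have eq: "real (q i) = of_int \<lfloor>Q * t i\<rfloor>" by (simp add: q_def)
    show "0 \<le> a i" "a i \<le> 1" unfolding a_def eq by linarith+
    have "real (q i) \<le> Q" using nn(2) unfolding eq by linarith
    then show "q i \<le> Q" by simp
  qed
  have \<kappa>: "0 \<le> \<kappa> k" for k unfolding \<kappa>_def by (intro divide_nonneg_nonneg moment_nonneg) auto
  have A2: "(A p i)\<^sup>2 = 2 * n * \<kappa> (snd p) * (c p i)\<^sup>2" for p i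
    using \<kappa> P(2) by (simp add: A_def power_mult_distrib)
  have Tu: "(cmod (\<Sum>i\<in>I. g i * iexp (t i * u)))\<^sup>2 \<le>
       2 * n * (\<Sum>p\<in>P. ((\<bar>u\<bar> / Q) ^ snd p / fact (snd p) * \<bar>\<Sum>i\<in>I. c p i * g i\<bar>)\<^sup>2) +
       2 * real (card I) * (\<Sum>i\<in>I. (\<bar>g i\<bar> * ((\<bar>u\<bar> / Q) ^ m / fact m))\<^sup>2)" for g u
  proof -
    define e where "e l = iexp (real l * u / Q)" for l :: nat
    define v where "v = u / Q"
    define R where "R i = iexp (a i * v) - (\<Sum>k<m. (\<i> * complex_of_real (a i * v)) ^ k / fact k)" for i
    have R: "cmod (R i) \<le> \<bar>v\<bar> ^ m / fact m" if "i \<in> I" for i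
    proof -
      have "cmod (R i) \<le> \<bar>a i * v\<bar> ^ m / fact m" unfolding R_def using assms(3) by (rule iexp_remainder)
      also have "\<dots> \<le> \<bar>v\<bar> ^ m / fact m"
        using q[OF that] by (intro divide_right_mono power_mono) (auto simp: abs_mult mult_left_le_one_le)
      finally show ?thesis .
    qed
    have ti: "iexp (t i * u) = e (q i) * (\<Sum>k<m. (\<i> * v) ^ k / fact k * a i ^ k) + e (q i) * R i" for i
    proof -
      have "t i * u = real (q i) * u / Q + a i * v" using assms(2) by (simp add: a_def v_def field_simps)
      then have "iexp (t i * u) = e (q i) * iexp (a i * v)"
        by (simp add: e_def distrib_left exp_add)
      then show ?thesis by (simp add: R_def algebra_simps power_mult_distrib)
    qed
    have main: "e (q i) * (\<Sum>k<m. (\<i> * v) ^ k / fact k * a i ^ k) =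
        (\<Sum>p\<in>P. e (fst p) * ((\<i> * v) ^ snd p / fact (snd p)) * c p i)" if "i \<in> I" for i
    proof -
      have "(\<Sum>p\<in>P. e (fst p) * ((\<i> * v) ^ snd p / fact (snd p)) * c p i) =
            (\<Sum>l\<le>Q. \<Sum>k<m. e l * ((\<i> * v) ^ k / fact k) * (if l = q i then a i ^ k else 0))"
        unfolding P_def c_def by (subst sum.cartesian_product) (simp add: split_beta)
      also have "\<dots> = (\<Sum>l\<le>Q. if l = q i then (\<Sum>k<m. e l * ((\<i> * v) ^ k / fact k) * a i ^ k) else 0)"
        by (intro sum.cong refl) simp
      also have "\<dots> = (\<Sum>k<m. e (q i) * ((\<i> * v) ^ k / fact k) * a i ^ k)"
        using q(1)[OF that] by simp
      finally show ?thesis by (simp add: sum_distrib_left mult.assoc)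
    qed
    have "(\<Sum>i\<in>I. g i * iexp (t i * u)) =
        (\<Sum>i\<in>I. g i * (\<Sum>p\<in>P. e (fst p) * ((\<i> * v) ^ snd p / fact (snd p)) * c p i)) + (\<Sum>i\<in>I. g i * (e (q i) * R i))"
      unfolding sum.distrib[symmetric] by (intro sum.cong refl) (simp only: ti main distrib_left)
    also have "(\<Sum>i\<in>I. g i * (\<Sum>p\<in>P. e (fst p) * ((\<i> * v) ^ snd p / fact (snd p)) * c p i)) =
        (\<Sum>p\<in>P. e (fst p) * ((\<i> * v) ^ snd p / fact (snd p)) * complex_of_real (\<Sum>i\<in>I. c p i * g i))"
      unfolding sum_distrib_left of_real_sum by (subst sum.swap) (simp add: mult_ac)
    finally have eqn: "(\<Sum>i\<in>I. g i * iexp (t i * u)) =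
        (\<Sum>p\<in>P. e (fst p) * ((\<i> * v) ^ snd p / fact (snd p)) * complex_of_real (\<Sum>i\<in>I. c p i * g i)) +
        (\<Sum>i\<in>I. g i * (e (q i) * R i))" .
    have "cmod (\<Sum>i\<in>I. g i * iexp (t i * u)) \<le>
        (\<Sum>p\<in>P. cmod (e (fst p) * ((\<i> * v) ^ snd p / fact (snd p)) * complex_of_real (\<Sum>i\<in>I. c p i * g i))) +
        (\<Sum>i\<in>I. cmod (g i * (e (q i) * R i)))"
      unfolding eqn by (intro norm_triangle_mono norm_sum)
    also have "(\<Sum>p\<in>P. cmod (e (fst p) * ((\<i> * v) ^ snd p / fact (snd p)) * complex_of_real (\<Sum>i\<in>I. c p i * g i))) =
        (\<Sum>p\<in>P. (\<bar>u\<bar> / Q) ^ snd p / fact (snd p) * \<bar>\<Sum>i\<in>I. c p i * g i\<bar>)"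
      by (intro sum.cong refl, simp only: norm_mult norm_divide norm_power norm_of_real)
         (simp add: e_def v_def abs_divide)
    also have "(\<Sum>i\<in>I. cmod (g i * (e (q i) * R i))) \<le> (\<Sum>i\<in>I. \<bar>g i\<bar> * ((\<bar>u\<bar> / Q) ^ m / fact m))"
    proof (rule sum_mono)
      fix i assume "i \<in> I"
      have "cmod (g i * (e (q i) * R i)) = \<bar>g i\<bar> * cmod (R i)" by (simp add: norm_mult e_def)
      also have "\<dots> \<le> \<bar>g i\<bar> * (\<bar>v\<bar> ^ m / fact m)" using R[OF \<open>i \<in> I\<close>] by (intro mult_left_mono) auto
      also have "\<bar>v\<bar> = \<bar>u\<bar> / Q" by (simp add: v_def abs_divide)
      finally show "cmod (g i * (e (q i) * R i)) \<le> \<bar>g i\<bar> * ((\<bar>u\<bar> / Q) ^ m / fact m)" .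
    qed
    finally show ?thesis
      unfolding P(2)[symmetric] by (intro sum_bound_square) auto
  qed
  have "covar_form I t g \<le> (\<Sum>p\<in>P. (\<Sum>i\<in>I. A p i * g i)\<^sup>2) + 2 * real (card I) * \<beta> * (\<Sum>i\<in>I. (g i)\<^sup>2)" for g
  proof -
    define G where "G p = \<bar>\<Sum>i\<in>I. c p i * g i\<bar>" for p
    define W where "W u k = f u * u ^ (2 * k) / (fact k * real Q ^ k)\<^sup>2" for u k
    have Wi: "integrable lborel (\<lambda>u. W u k)" "(\<integral>u. W u k \<partial>lborel) = \<kappa> k" for k
      unfolding W_def using moments by (auto simp: \<kappa>_def moment_def)
    have sq: "f u * ((\<bar>u\<bar> / Q) ^ k / fact k * x)\<^sup>2 = W u k * x\<^sup>2" for u k x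
      by (simp add: W_def power_mult_distrib power_divide power_mult power_even_abs power2_eq_square[of "fact k"] field_simps flip: power_mult)
    have "covar_form I t g \<le> (\<integral>u. 2 * n * (\<Sum>p\<in>P. W u (snd p) * (G p)\<^sup>2) + 2 * real (card I) * (\<Sum>i\<in>I. W u m * (g i)\<^sup>2) \<partial>lborel)"
      unfolding covar_form_def
    proof (rule integral_mono[OF covar_integrable])
      show "integrable lborel (\<lambda>u. 2 * n * (\<Sum>p\<in>P. W u (snd p) * (G p)\<^sup>2) + 2 * real (card I) * (\<Sum>i\<in>I. W u m * (g i)\<^sup>2))"
        using Wi by auto
      fix u
      have "f u * (\<bar>g i\<bar> * ((\<bar>u\<bar> / Q) ^ m / fact m))\<^sup>2 = W u m * (g i)\<^sup>2" for i
        using sq[of u m "\<bar>g i\<bar>"] by (simp add: mult.commute)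
      then show "f u * (cmod (\<Sum>i\<in>I. g i * iexp (t i * u)))\<^sup>2 \<le>
          2 * n * (\<Sum>p\<in>P. W u (snd p) * (G p)\<^sup>2) + 2 * real (card I) * (\<Sum>i\<in>I. W u m * (g i)\<^sup>2)"
        using mult_left_mono[OF Tu[of g u] f_nonneg[of u]]
        by (simp only: distrib_left mult.left_commute[of "f u"] sum_distrib_left sq G_def)
    qed
    also have "\<dots> = 2 * n * (\<Sum>p\<in>P. \<kappa> (snd p) * (G p)\<^sup>2) + 2 * real (card I) * (\<Sum>i\<in>I. \<kappa> m * (g i)\<^sup>2)"
      using Wi by simp
    also have "2 * n * (\<Sum>p\<in>P. \<kappa> (snd p) * (G p)\<^sup>2) = (\<Sum>p\<in>P. (\<Sum>i\<in>I. A p i * g i)\<^sup>2)"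
    proof -
      have "(\<Sum>i\<in>I. A p i * g i)\<^sup>2 = 2 * n * (\<kappa> (snd p) * (G p)\<^sup>2)" for p
      proof -
        have "(\<Sum>i\<in>I. A p i * g i) = sqrt (2 * n * \<kappa> (snd p)) * (\<Sum>i\<in>I. c p i * g i)"
          by (simp add: A_def sum_distrib_left mult.assoc)
        then show ?thesis using \<kappa> P(2) by (simp add: G_def power_mult_distrib)
      qed
      then show ?thesis by (simp add: sum_distrib_left)
    qed
    also have "2 * real (card I) * (\<Sum>i\<in>I. \<kappa> m * (g i)\<^sup>2) \<le> 2 * real (card I) * \<beta> * (\<Sum>i\<in>I. (g i)\<^sup>2)"
    proof -
      have "(\<Sum>i\<in>I. \<kappa> m * (g i)\<^sup>2) \<le> (\<Sum>i\<in>I. \<beta> * (g i)\<^sup>2)"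
        using \<beta> by (intro sum_mono mult_right_mono) (auto simp: \<kappa>_def)
      then show ?thesis by (simp add: mult.assoc sum_distrib_left[symmetric] mult_left_mono)
    qed
    finally show ?thesis by simp
  qed
  moreover have "(\<Sum>i\<in>I. \<Sum>p\<in>P. (A p i)\<^sup>2) \<le> 2 * real (card I) * n\<^sup>2 * B"
  proof -
    have "(A p i)\<^sup>2 \<le> 2 * n * B" if "i \<in> I" "p \<in> P" for i p
    proof -
      have "(c p i)\<^sup>2 \<le> 1" using q[OF that(1)] by (auto simp: c_def split_beta power_le_one)
      moreover have "\<kappa> (snd p) \<le> B" using B that(2) by (auto simp: \<kappa>_def P_def)
      ultimately have "\<kappa> (snd p) * (c p i)\<^sup>2 \<le> B * 1" using \<kappa>[of "snd p"] by (intro mult_mono) auto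
      then show ?thesis unfolding A2 using P(2) by (simp add: mult.assoc mult_left_mono flip: P(2))
    qed
    then have "(\<Sum>i\<in>I. \<Sum>p\<in>P. (A p i)\<^sup>2) \<le> (\<Sum>i\<in>I. \<Sum>p\<in>P. 2 * n * B)" by (intro sum_mono) auto
    also have "\<dots> = 2 * real (card I) * n\<^sup>2 * B" using P(2) by (simp add: power2_eq_square)
    finally show ?thesis .
  qed
  ultimately show ?thesis using that unfolding P_def n_def by blast
qed

text \<open>The Taylor form is fed into the low-rank cube bound on the grid of \<open>N\<close>
  points with radius r / 2, and the chaining loss is subtracted. \<open>n\<close> is the rank,
  \<open>B\<close> bounds the normalised moments below degree m, and \<beta> the one in the
  remainder.\<close>

lemma ball_prob_ge:
  fixes Q m K :: nat and D r \<epsilon> B \<beta> :: real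
  defines "N \<equiv> 2 ^ K + 1 :: real" and "n \<equiv> (real Q + 1) * m"
  assumes "0 < D" "moment 1 \<le> D" "0 < r" "0 < \<epsilon>" and y: "y = r\<^sup>2 * 4 ^ K / (64 * D)" "3 \<le> y"
    and "0 < Q" "0 < m" "0 \<le> \<beta>"
    and B: "\<And>k. k < m \<Longrightarrow> moment k / (fact k * real Q ^ k)\<^sup>2 \<le> B"
    and \<beta>: "moment m / (fact m * real Q ^ m)\<^sup>2 \<le> \<beta>"
  shows "(1 + 4 * N * n\<^sup>2 * B / \<epsilon>\<^sup>2) powr (- n / 2) * (1 + 4 * N * \<beta> / \<epsilon>\<^sup>2) powr (- N / 2)
          - exp (- (r\<^sup>2 / (8 * \<epsilon>\<^sup>2))) - 2 * 2 ^ K * exp (- y) \<le> ball_prob r"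
proof -
  define I where "I = {..(2::nat) ^ K}"
  define t where "t i = real i / 2 ^ K" for i :: nat
  have N: "real (card I) = N" by (simp add: I_def N_def)
  have t: "t i \<in> {0..1}" if "i \<in> I" for i
  proof -
    have "real i \<le> real (2 ^ K)" using that unfolding of_nat_le_iff by (simp add: I_def)
    then show ?thesis by (simp add: t_def)
  qed
  obtain A :: "nat \<times> nat \<Rightarrow> nat \<Rightarrow> real" where A:
    "\<And>g. covar_form I t g \<le> (\<Sum>p\<in>{..Q} \<times> {..<m}. (\<Sum>i\<in>I. A p i * g i)\<^sup>2) + 2 * real (card I) * \<beta> * (\<Sum>i\<in>I. (g i)\<^sup>2)"
    "(\<Sum>i\<in>I. \<Sum>p\<in>{..Q} \<times> {..<m}. (A p i)\<^sup>2) \<le> 2 * real (card I) * ((real Q + 1) * m)\<^sup>2 * B"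
    by (rule covar_form_piecewise_taylor[where I=I and t=t and Q=Q and m=m and B=B and \<beta>=\<beta>]) (use assms t in \<open>auto simp: I_def\<close>)
  note A = A[unfolded N n_def[symmetric]]
  have "0 \<le> N" by (simp add: N_def)
  have "(1 + 2 * (2 * N * n\<^sup>2 * B) / \<epsilon>\<^sup>2) powr (- real (card ({..Q} \<times> {..<m})) / 2)
        * (1 + 2 * (2 * N * \<beta>) / \<epsilon>\<^sup>2) powr (- real (card I) / 2) - exp (- ((r / 2)\<^sup>2 / (2 * \<epsilon>\<^sup>2)))
        \<le> prob {\<omega> \<in> space M. \<forall>i\<in>I. \<bar>X (t i) \<omega>\<bar> \<le> r / 2}"
    by (rule prob_cube_ge_low_rank[where A=A])
       (use A \<open>0 \<le> N\<close> \<open>0 \<le> \<beta>\<close> \<open>0 < r\<close> \<open>0 < \<epsilon>\<close> in \<open>auto simp: I_def\<close>)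
  moreover have "real (card ({..Q} \<times> {..<m})) = n" by (simp add: n_def algebra_simps)
  moreover have "(r / 2)\<^sup>2 / (2 * \<epsilon>\<^sup>2) = r\<^sup>2 / (8 * \<epsilon>\<^sup>2)" by (simp add: power_divide)
  moreover have "2 * (2 * N * n\<^sup>2 * B) = 4 * N * n\<^sup>2 * B" "2 * (2 * N * \<beta>) = 4 * N * \<beta>" by simp_all
  ultimately have "(1 + 4 * N * n\<^sup>2 * B / \<epsilon>\<^sup>2) powr (- n / 2) * (1 + 4 * N * \<beta> / \<epsilon>\<^sup>2) powr (- N / 2)
        - exp (- (r\<^sup>2 / (8 * \<epsilon>\<^sup>2)))
        \<le> prob {\<omega> \<in> space M. \<forall>i\<in>{..2 ^ K}. \<bar>X (real i / 2 ^ K) \<omega>\<bar> \<le> r / 2}"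
    by (simp only: N) (simp only: I_def t_def)
  then show ?thesis
    using ball_prob_ge_grid[OF assms(3-5) y] by linarith
qed

end

section \<open>Moments of stretched exponential densities\<close>

text \<open>The single term k^k / k! of the exponential series is at most exp k.\<close>

lemma power_le_fact: "(real k / exp 1) ^ k \<le> fact k"
proof -
  obtain t where "exp (real k) = (\<Sum>m<Suc k. real k ^ m / fact m) + exp t / fact (Suc k) * real k ^ Suc k"
    using Maclaurin_exp_le by blast
  moreover have "real k ^ k / fact k \<le> (\<Sum>m<Suc k. real k ^ m / fact m)"
    by (rule member_le_sum) auto
  moreover have "0 \<le> exp t / fact (Suc k) * real k ^ Suc k" by (intro mult_nonneg_nonneg) auto
  ultimately have "real k ^ k / fact k \<le> exp (real k)" by linarith
  moreover have "exp (real k) = exp 1 ^ k" by (simp flip: exp_of_nat_mult)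
  ultimately show ?thesis by (simp add: power_divide field_simps)
qed

text \<open>The right side is the maximum, attained at x = 2 s; this is ln z \<le> z - 1 at z = x /
  (2 s).\<close>

lemma powr_times_exp_bound:
  fixes x s :: real
  assumes "0 \<le> x" "0 < s"
  shows "x powr s * exp (- x / 2) \<le> (2 * s / exp 1) powr s"
proof (cases "x = 0")
  case False
  then have x: "0 < x" using assms by simp
  have "ln (x / (2 * s)) \<le> x / (2 * s) - 1" using x assms by (intro ln_le_minus_one) auto
  then have "s * ln (x / (2 * s)) \<le> s * (x / (2 * s) - 1)" using assms by (intro mult_left_mono) auto
  also have "\<dots> = x / 2 - s" using assms by (simp add: field_simps)
  finally have "s * ln x - x / 2 \<le> s * (ln (2 * s) - 1)"
    using x assms by (simp add: ln_div algebra_simps)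
  also have "ln (2 * s) - 1 = ln (2 * s / exp 1)" using assms by (simp add: ln_div)
  finally have "exp (s * ln x - x / 2) \<le> exp (s * ln (2 * s / exp 1))" by simp
  moreover have "exp (s * ln x - x / 2) = x powr s * exp (- x / 2)"
    using x by (simp add: powr_def flip: exp_add)
  ultimately show ?thesis using assms by (simp add: powr_def)
qed simp

text \<open>Taking the exponent 2 / \<alpha> in \<open>powr_times_exp_bound\<close> produces u^2, so
  a multiple of 1 / (1 + u^2) dominates.\<close>

lemma integrable_stretched_exp:
  assumes "0 < \<alpha>"
  shows "integrable lborel (\<lambda>u::real. exp (- (\<bar>u\<bar> powr \<alpha>) / 2))"
proof (rule Bochner_Integration.integrable_bound)
  define c where "c = (2 * (2 / \<alpha>) / exp 1) powr (2 / \<alpha>)"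
  have "set_integrable lborel UNIV (\<lambda>x::real. inverse (1 + x^2))"
    using integrable_inverse_1_plus_square by simp
  then show "integrable lborel (\<lambda>u::real. (1 + c) * inverse (1 + u^2))"
    by (simp add: set_integrable_def)
  show "AE u in lborel. norm (exp (- (\<bar>u\<bar> powr \<alpha>) / 2)) \<le> norm ((1 + c) * inverse (1 + u^2))"
  proof (rule AE_I2)
    fix u :: real
    define E where "E = exp (- (\<bar>u\<bar> powr \<alpha>) / 2)"
    have "(\<bar>u\<bar> powr \<alpha>) powr (2 / \<alpha>) * E \<le> c"
      unfolding E_def c_def using assms by (intro powr_times_exp_bound) auto
    moreover have "(\<bar>u\<bar> powr \<alpha>) powr (2 / \<alpha>) = u\<^sup>2"
      using assms by (cases "u = 0") (simp_all add: powr_powr)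
    moreover have "E \<le> 1" by (simp add: E_def)
    ultimately have "(1 + u\<^sup>2) * E \<le> 1 + c" by (simp add: algebra_simps)
    moreover have "0 < 1 + u\<^sup>2" by (simp add: add_pos_nonneg)
    ultimately have "E \<le> (1 + c) * inverse (1 + u\<^sup>2)" by (simp add: field_simps)
    moreover have "0 \<le> E" by (simp add: E_def)
    ultimately show "norm E \<le> norm ((1 + c) * inverse (1 + u^2))" by simp
  qed
qed simp

text \<open>The constant \<open>C\<close> lets the indicator of [-1, 1] be covered too, with
  \<alpha> = 2 and C = exp 1.\<close>

locale stretched_spectral_gaussian = spectral_gaussian +
  fixes C \<alpha> :: real
  assumes \<alpha>_pos: "0 < \<alpha>" and f_le: "f u \<le> C * exp (- (\<bar>u\<bar> powr \<alpha>))"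
begin

lemma C_nonneg: "0 \<le> C"
  using f_le[of 0] f_nonneg[of 0] by simp

text \<open>The exponential is split into two equal halves: one absorbs the power of u, the other is
  kept for integrability.\<close>

lemma f_power_le:
  assumes "0 < k"
  shows "f u * u ^ (2 * k) \<le> C * (2 * (2 * real k / \<alpha>) / exp 1) powr (2 * real k / \<alpha>) * exp (- (\<bar>u\<bar> powr \<alpha>) / 2)"
proof -
  define E where "E = exp (- (\<bar>u\<bar> powr \<alpha>) / 2)"
  define s where "s = 2 * real k / \<alpha>"
  have "(\<bar>u\<bar> powr \<alpha>) powr s * E \<le> (2 * s / exp 1) powr s"
    unfolding E_def using assms \<alpha>_pos by (intro powr_times_exp_bound) (auto simp: s_def)
  moreover have "(\<bar>u\<bar> powr \<alpha>) powr s = u ^ (2 * k)"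
  proof (cases "u = 0")
    case True
    then show ?thesis using assms by simp
  next
    case False
    then have "(\<bar>u\<bar> powr \<alpha>) powr s = \<bar>u\<bar> powr real (2 * k)"
      using \<alpha>_pos by (simp add: powr_powr s_def)
    also have "\<dots> = \<bar>u\<bar> ^ (2 * k)" using False by (intro powr_realpow) auto
    finally show ?thesis by (simp add: power_even_abs)
  qed
  ultimately have *: "u ^ (2 * k) * E \<le> (2 * s / exp 1) powr s" by simp
  have "f u * u ^ (2 * k) \<le> C * exp (- (\<bar>u\<bar> powr \<alpha>)) * u ^ (2 * k)"
    using f_le by (intro mult_right_mono) auto
  also have "exp (- (\<bar>u\<bar> powr \<alpha>)) = E * E" by (simp add: E_def flip: exp_add)
  also have "C * (E * E) * u ^ (2 * k) = C * (u ^ (2 * k) * E) * E" by (simp add: mult_ac)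
  also have "\<dots> \<le> C * (2 * s / exp 1) powr s * E"
    using * C_nonneg by (intro mult_left_mono mult_right_mono) (auto simp: E_def)
  finally show ?thesis by (simp add: s_def E_def)
qed

end

sublocale stretched_spectral_gaussian \<subseteq> smooth_spectral_gaussian
proof
  fix k
  show "integrable lborel (\<lambda>u. f u * u ^ (2 * k))"
  proof (cases "k = 0")
    case True
    then show ?thesis using f_integrable by simp
  next
    case False
    show ?thesis
    proof (rule Bochner_Integration.integrable_bound)
      define c where "c = C * (2 * (2 * real k / \<alpha>) / exp 1) powr (2 * real k / \<alpha>)"
      show "integrable lborel (\<lambda>u. c * exp (- (\<bar>u\<bar> powr \<alpha>) / 2))"
        using integrable_stretched_exp[OF \<alpha>_pos] by simp
      have "norm (f u * u ^ (2 * k)) \<le> norm (c * exp (- (\<bar>u\<bar> powr \<alpha>) / 2))" for u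
      proof -
        have "norm (f u * u ^ (2 * k)) = f u * u ^ (2 * k)" using f_nonneg[of u] by simp
        also have "\<dots> \<le> c * exp (- (\<bar>u\<bar> powr \<alpha>) / 2)"
          unfolding c_def using False by (intro f_power_le) simp
        finally show ?thesis by simp
      qed
      then show "AE u in lborel. norm (f u * u ^ (2 * k)) \<le> norm (c * exp (- (\<bar>u\<bar> powr \<alpha>) / 2))"
        by (rule AE_I2)
    qed simp
  qed
qed

context stretched_spectral_gaussian
begin

text \<open>Moments grow like k^(2 k / \<alpha>), and dividing by the squared factorial leaves the
  base k^(1 / \<alpha> - 1). This is the dichotomy: for \<alpha> > 1 the base decays by itself,
  whereas for \<alpha> < 1 it grows and must be offset by \<open>Q\<close>.\<close>

lemma moment_bound:
  obtains C1 C2 where "1 \<le> C1" "1 \<le> C2" "moment 0 \<le> C1"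
    "\<And>k Q. 0 < k \<Longrightarrow> 0 < Q \<Longrightarrow>
       moment k / (fact k * real Q ^ k)\<^sup>2 \<le> C1 * (C2 * real k powr (1 / \<alpha> - 1) / real Q) ^ (2 * k)"
proof -
  define D where "D = (\<integral>u. exp (- (\<bar>u\<bar> powr \<alpha>) / 2) \<partial>lborel)"
  define c where "c = (4 / (\<alpha> * exp 1)) powr (1 / \<alpha>)"
  have "0 \<le> D" unfolding D_def by (intro integral_nonneg_AE AE_I2) auto
  have c: "0 < c" using \<alpha>_pos by (simp add: c_def)
  have bound: "moment k / (fact k * real Q ^ k)\<^sup>2 \<le> C * D * (c * exp 1 * real k powr (1 / \<alpha> - 1) / real Q) ^ (2 * k)"
    if "0 < k" "0 < Q" for k Q
  proof -
    have "moment k \<le> (\<integral>u. C * (2 * (2 * real k / \<alpha>) / exp 1) powr (2 * real k / \<alpha>) * exp (- (\<bar>u\<bar> powr \<alpha>) / 2) \<partial>lborel)"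
      unfolding moment_def using integrable_stretched_exp[OF \<alpha>_pos] \<open>0 < k\<close>
      by (intro integral_mono moments f_power_le) auto
    also have "\<dots> = C * D * (2 * (2 * real k / \<alpha>) / exp 1) powr (2 * real k / \<alpha>)"
      by (simp add: D_def)
    also have "(2 * (2 * real k / \<alpha>) / exp 1) powr (2 * real k / \<alpha>) = (c * real k powr (1 / \<alpha>)) ^ (2 * k)"
    proof -
      have "c * real k powr (1 / \<alpha>) = (2 * (2 * real k / \<alpha>) / exp 1) powr (1 / \<alpha>)"
        unfolding c_def using \<alpha>_pos by (subst powr_mult[symmetric]) auto
      then have "(c * real k powr (1 / \<alpha>)) ^ (2 * k) = ((2 * (2 * real k / \<alpha>) / exp 1) powr (1 / \<alpha>)) powr real (2 * k)"
        using \<open>0 < k\<close> \<alpha>_pos by (subst powr_realpow) auto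
      then show ?thesis by (simp add: powr_powr)
    qed
    finally have "moment k / (fact k * real Q ^ k)\<^sup>2 \<le> C * D * (c * real k powr (1 / \<alpha>)) ^ (2 * k) / (fact k * real Q ^ k)\<^sup>2"
      by (intro divide_right_mono) auto
    also have "\<dots> \<le> C * D * (c * real k powr (1 / \<alpha>)) ^ (2 * k) / ((real k / exp 1) ^ k * real Q ^ k)\<^sup>2"
    proof (intro divide_left_mono power_mono mult_right_mono power_le_fact)
      show "0 \<le> C * D * (c * real k powr (1 / \<alpha>)) ^ (2 * k)" using C_nonneg \<open>0 \<le> D\<close> by simp
    qed (use that in auto)
    also have "((real k / exp 1) ^ k * real Q ^ k)\<^sup>2 = (real k / exp 1 * real Q) ^ (2 * k)"
      by (simp only: power_mult_distrib[symmetric] power_mult[symmetric] mult.commute[of 2])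
    also have "C * D * (c * real k powr (1 / \<alpha>)) ^ (2 * k) / (real k / exp 1 * real Q) ^ (2 * k) =
        C * D * (c * real k powr (1 / \<alpha>) / (real k / exp 1 * real Q)) ^ (2 * k)"
      by (simp only: power_divide times_divide_eq_right)
    also have "c * real k powr (1 / \<alpha>) / (real k / exp 1 * real Q) = c * exp 1 * real k powr (1 / \<alpha> - 1) / real Q"
      using that by (simp add: powr_diff field_simps)
    finally show ?thesis .
  qed
  show thesis
  proof (rule that[of "max 1 (max (C * D) (moment 0))" "max 1 (c * exp 1)"])
    fix k Q :: nat assume kQ: "0 < k" "0 < Q"
    have "C * D * (c * exp 1 * real k powr (1 / \<alpha> - 1) / real Q) ^ (2 * k)
       \<le> max 1 (max (C * D) (moment 0)) * (max 1 (c * exp 1) * real k powr (1 / \<alpha> - 1) / real Q) ^ (2 * k)"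
      using c by (intro mult_mono power_mono divide_right_mono) auto
    with bound[OF kQ] show "moment k / (fact k * real Q ^ k)\<^sup>2
      \<le> max 1 (max (C * D) (moment 0)) * (max 1 (c * exp 1) * real k powr (1 / \<alpha> - 1) / real Q) ^ (2 * k)"
      by linarith
  qed auto
qed

end

section \<open>Choice of grid and scale in the lower bound for the probability\<close>

context smooth_spectral_gaussian
begin

text \<open>Scale \<epsilon> = r^2 and mesh about r^2 make every base in the rank factor a power of
  1 / r, so that factor is at least exp (- 11/2 n L), where n = (Q + 1) m and L = - ln r. The errors
  are of order exp (- c / r^2) up to powers of r, hence negligible as long as n L is at most 1 / r.
  The constant 6 is 11/2 plus 1/2, the latter absorbing a factor 1/4.\<close>

lemma ball_prob_ge_exp:
  "\<forall>\<^sub>F r in at_right 0. \<forall>Q m :: nat. 0 < Q \<longrightarrow> 0 < m \<longrightarrow>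
     (real Q + 1) * m * - ln r \<le> 1 / r \<longrightarrow>
     (\<forall>k<m. moment k / (fact k * real Q ^ k)\<^sup>2 \<le> 1 / r ^ 2) \<longrightarrow>
     moment m / (fact m * real Q ^ m)\<^sup>2 \<le> r ^ 12 \<longrightarrow>
     exp (- (6 * ((real Q + 1) * m * - ln r))) \<le> ball_prob r"
proof -
  define D where "D = moment 1 + 1"
  define c where "c = 1 / (64 * D)"
  have D: "1 \<le> D" "moment 1 \<le> D" using moment_nonneg[of 1] by (auto simp: D_def)
  have c: "0 < c" "c \<le> 1 / 8" using D by (auto simp: c_def field_simps)
  \<comment> \<open>The 5 collects the cube error with coefficient 1 and the chaining error with
    coefficient 4.\<close>
  have ev1: "\<forall>\<^sub>F r in at_right (0::real). 5 / r ^ 2 * exp (- (c / r ^ 2)) \<le> 1 / 4 * exp (- 6 / r)"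
    using c by real_asymp
  have ev2: "\<forall>\<^sub>F r in at_right (0::real). 3 \<le> c / r ^ 2" using c by real_asymp
  have ev3: "\<forall>\<^sub>F r in at_right (0::real). 0 < r \<and> r < 1 / 16"
    by (rule eventually_at_rightI[of 0 "1/16"]) auto
  from ev1 ev2 ev3 show ?thesis
  proof eventually_elim
    case (elim r)
    then have r: "0 < r" "r < 1 / 16" by auto
    define L where "L = - ln r"
    have "exp 1 \<le> (16 :: real)" using exp_le by linarith
    then have "ln r \<le> ln (1 / exp 1)" using r by (intro ln_mono) (auto simp: field_simps intro: order_trans[of _ "r * 16"])
    then have L1: "1 \<le> L" by (simp add: L_def ln_div)
    show ?case
    proof (intro allI impI, fold L_def)
      fix Q m :: nat
      assume Qm: "0 < Q" "0 < m" and nL: "(real Q + 1) * m * L \<le> 1 / r"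
        and B: "\<forall>k<m. moment k / (fact k * real Q ^ k)\<^sup>2 \<le> 1 / r ^ 2"
        and \<beta>: "moment m / (fact m * real Q ^ m)\<^sup>2 \<le> r ^ 12"
      define n where "n = (real Q + 1) * m"
      have "1 * 1 \<le> n" unfolding n_def using Qm by (intro mult_mono) auto
      then have n1: "1 \<le> n" by simp
      have "n * 1 \<le> n * L" using n1 L1 by (intro mult_left_mono) auto
      then have nr: "n \<le> 1 / r" using nL unfolding n_def[symmetric] by linarith
      \<comment> \<open>The least K with 2^K at least 1 / r^2; then \<open>y\<close> is at least c /
        r^2, while the grid has at most 3 / r^2 points.\<close>
      define K where "K = nat \<lceil>log 2 (1 / r ^ 2)\<rceil>"
      have r2: "1 \<le> 1 / r ^ 2" using r by (simp add: field_simps power_le_one)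
      then have lg: "0 \<le> log 2 (1 / r ^ 2)" using r by (subst zero_le_log_cancel_iff) auto
      then have K: "log 2 (1 / r ^ 2) \<le> K" "K \<le> log 2 (1 / r ^ 2) + 1" by (auto simp: K_def)
      have "2 powr (log 2 (1 / r ^ 2)) \<le> 2 powr K" using K(1) by (intro powr_mono) auto
      then have K1: "1 / r ^ 2 \<le> 2 ^ K" using r r2 by (simp add: powr_realpow)
      have "2 powr K \<le> 2 powr (log 2 (1 / r ^ 2) + 1)" using K(2) by (intro powr_mono) auto
      then have K2: "2 ^ K \<le> 2 / r ^ 2" using r r2 by (simp add: powr_realpow powr_add)
      define N where "N = 2 ^ K + (1::real)"
      have N: "1 \<le> N" "N \<le> 3 / r ^ 2" using K2 r2 by (auto simp: N_def)
      define y where "y = r\<^sup>2 * 4 ^ K / (64 * D)"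
      have "(1 / r ^ 2)\<^sup>2 \<le> (2 ^ K)\<^sup>2" using K1 by (intro power_mono) auto
      also have "\<dots> = (4::real) ^ K" by (simp flip: power_mult_distrib add: power2_eq_square)
      finally have "r\<^sup>2 * (1 / r ^ 2)\<^sup>2 * c \<le> r\<^sup>2 * 4 ^ K * c" using c by (intro mult_right_mono mult_left_mono) auto
      moreover have "r\<^sup>2 * (1 / r ^ 2)\<^sup>2 * c = c / r ^ 2" using r by (simp add: field_simps power2_eq_square)
      ultimately have cy: "c / r ^ 2 \<le> y" by (simp add: y_def c_def)
      have "(1 + 4 * N * n\<^sup>2 * (1 / r ^ 2) / (r ^ 2)\<^sup>2) powr (- n / 2) * (1 + 4 * N * r ^ 12 / (r ^ 2)\<^sup>2) powr (- N / 2)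
          - exp (- (r\<^sup>2 / (8 * (r ^ 2)\<^sup>2))) - 2 * 2 ^ K * exp (- y) \<le> ball_prob r"
        unfolding n_def N_def using B \<beta> r Qm D cy elim(2)
        by (intro ball_prob_ge[where D=D]) (auto simp: y_def)
      moreover have "exp (- (11 / 2 * (n * L))) \<le> (1 + 4 * N * n\<^sup>2 * (1 / r ^ 2) / (r ^ 2)\<^sup>2) powr (- n / 2)"
      proof -
        \<comment> \<open>Powers of 1 / r: two from \<open>N\<close>, two from n^2, two from the
          moment bound and four from \<epsilon>^2, ten in all. One more absorbs the constant 13, as
          r < 1 / 16.\<close>
        have "4 * N * n\<^sup>2 * (1 / r ^ 2) / (r ^ 2)\<^sup>2 \<le> 4 * (3 / r ^ 2) * (1 / r)\<^sup>2 * (1 / r ^ 2) / (r ^ 2)\<^sup>2"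
          using N n1 nr r by (intro divide_right_mono mult_right_mono mult_mono power_mono) auto
        also have "\<dots> = 12 / r ^ 10" using r by (simp add: field_simps eval_nat_numeral)
        finally have "1 + 4 * N * n\<^sup>2 * (1 / r ^ 2) / (r ^ 2)\<^sup>2 \<le> 1 + 12 / r ^ 10" by simp
        also have "\<dots> \<le> 13 / r ^ 10" using r by (simp add: field_simps power_le_one)
        also have "\<dots> \<le> 1 / r ^ 11" using r by (simp add: field_simps eval_nat_numeral)
        finally have "(1 / r ^ 11) powr (- n / 2) \<le> (1 + 4 * N * n\<^sup>2 * (1 / r ^ 2) / (r ^ 2)\<^sup>2) powr (- n / 2)"
          using n1 N r by (intro powr_mono2') (auto intro!: add_pos_nonneg)
        moreover have "(1 / r ^ 11) powr (- n / 2) = exp (- (11 / 2 * (n * L)))"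
          using r by (simp add: powr_def ln_div ln_realpow L_def field_simps)
        ultimately show ?thesis by simp
      qed
      moreover have "1 / 2 \<le> (1 + 4 * N * r ^ 12 / (r ^ 2)\<^sup>2) powr (- N / 2)"
      proof -
        \<comment> \<open>The remainder threshold r^12 leaves x of order r^6, so even the power N /
          2, of order 1 / r^2, stays above 1 / 2.\<close>
        define x where "x = 4 * N * r ^ 12 / (r ^ 2)\<^sup>2"
        have x0: "0 \<le> x" using N by (simp add: x_def)
        have "x \<le> 4 * (3 / r ^ 2) * r ^ 12 / (r ^ 2)\<^sup>2"
          unfolding x_def using N r by (intro divide_right_mono mult_right_mono mult_left_mono) auto
        also have "\<dots> = 12 * r ^ 6" using r by (simp add: field_simps eval_nat_numeral)
        finally have "N / 2 * x \<le> (3 / r ^ 2) / 2 * (12 * r ^ 6)"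
          using N r x0 by (intro mult_mono) auto
        also have "\<dots> = 18 * r ^ 4" using r by (simp add: field_simps eval_nat_numeral)
        also have "\<dots> \<le> 18 * (1 / 16) ^ 4" using r by (intro mult_left_mono power_mono) auto
        also have "\<dots> \<le> 1 / 2" by (simp add: eval_nat_numeral)
        finally have Nx: "N / 2 * x \<le> 1 / 2" .
        have "N / 2 * ln (1 + x) \<le> N / 2 * x" using x0 N by (intro mult_left_mono ln_add_one_self_le_self) auto
        then have "1 / 2 \<le> 1 + - (N / 2 * ln (1 + x))" using Nx by linarith
        also have "\<dots> \<le> exp (- (N / 2 * ln (1 + x)))" by (rule exp_ge_add_one_self)
        also have "\<dots> = (1 + x) powr (- N / 2)" using x0 by (simp add: powr_def)
        finally show ?thesis by (simp add: x_def)
      qed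
      moreover have "exp (- (r\<^sup>2 / (8 * (r ^ 2)\<^sup>2))) \<le> 1 / r ^ 2 * exp (- (c / r ^ 2))"
      proof -
        have "c / r ^ 2 \<le> 1 / 8 / r ^ 2" using c by (intro divide_right_mono) auto
        also have "1 / 8 / r ^ 2 = r\<^sup>2 / (8 * (r ^ 2)\<^sup>2)" using r by (simp add: field_simps power2_eq_square)
        finally have "1 * exp (- (r\<^sup>2 / (8 * (r ^ 2)\<^sup>2))) \<le> 1 / r ^ 2 * exp (- (c / r ^ 2))"
          using r2 by (intro mult_mono) auto
        then show ?thesis by simp
      qed
      moreover have "2 * 2 ^ K * exp (- y) \<le> 4 / r ^ 2 * exp (- (c / r ^ 2))"
        using K2 cy by (intro mult_mono) auto
      moreover have "5 / r ^ 2 * exp (- (c / r ^ 2)) \<le> 1 / 4 * exp (- (11 / 2 * (n * L)))"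
      proof -
        have "11 / 2 * (n * L) \<le> 6 * (1 / r)" using nL n1 L1 unfolding n_def[symmetric] by (intro mult_mono) auto
        then have "exp (- 6 / r) \<le> exp (- (11 / 2 * (n * L)))" by simp
        with elim(1) show ?thesis by linarith
      qed
      moreover have "5 / r ^ 2 * exp (- (c / r ^ 2)) = 1 / r ^ 2 * exp (- (c / r ^ 2)) + 4 / r ^ 2 * exp (- (c / r ^ 2))"
        by (simp add: field_simps)
      moreover have "exp (- (11 / 2 * (n * L))) * (1 / 2) \<le> u * v" if "exp (- (11 / 2 * (n * L))) \<le> u" "1 / 2 \<le> v" for u v :: real
        using that by (intro mult_mono) (auto intro: order_trans[OF _ that(1)])
      ultimately have low: "1 / 4 * exp (- (11 / 2 * (n * L))) \<le> ball_prob r" by fastforce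
      have "exp (- (1 / 2 * (n * L))) \<le> exp (- (1 / 2 * L))" using n1 L1 by simp
      also have "\<dots> = sqrt r" using r by (simp add: L_def ln_sqrt[symmetric])
      also have "\<dots> \<le> sqrt ((1 / 4)\<^sup>2)" using r by (intro real_sqrt_le_mono) (simp add: power2_eq_square)
      also have "\<dots> = 1 / 4" by simp
      finally have "exp (- (1 / 2 * (n * L))) * exp (- (11 / 2 * (n * L))) \<le> 1 / 4 * exp (- (11 / 2 * (n * L)))"
        by (intro mult_right_mono) auto
      then have "exp (- (6 * (n * L))) \<le> 1 / 4 * exp (- (11 / 2 * (n * L)))"
        by (simp add: algebra_simps flip: exp_add)
      with low show "exp (- (6 * ((real Q + 1) * m * L))) \<le> ball_prob r" by (simp add: n_def)
    qed
  qed
qed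

end

section \<open>Asymptotic orders\<close>

text \<open>Substitution r = exp (- L): L tends to infinity, and |ln r| equals L once r < 1.\<close>

lemma eventually_at_right_0_ln:
  fixes P :: "real \<Rightarrow> real \<Rightarrow> bool"
  assumes "\<forall>\<^sub>F L in at_top. P (exp (- L)) L"
  shows "\<forall>\<^sub>F r in at_right 0. P r \<bar>ln r\<bar>"
proof -
  have "filterlim (\<lambda>r::real. - ln r) at_top (at_right 0)" by real_asymp
  then have "\<forall>\<^sub>F r in at_right 0. P (exp (- (- ln r))) (- ln r)"
    by (rule eventually_compose_filterlim[where P="\<lambda>L. P (exp (- L)) L", OF assms])
  moreover have "\<forall>\<^sub>F r in at_right (0::real). 0 < r \<and> r < 1"
    by (rule eventually_at_rightI[of 0 1]) auto
  ultimately show ?thesis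
    by eventually_elim (auto simp: abs_of_nonpos)
qed

lemma asymp_equiv_orderI:
  assumes "0 < c" "0 < C"
    and bounds: "\<forall>\<^sub>F L in at_top. 0 < h L \<and> c * h L \<le> f (exp (- L)) \<and> f (exp (- L)) \<le> C * h L"
  shows "asymp_equiv_order f (\<lambda>r. h \<bar>ln r\<bar>)"
proof -
  define g where "g r = h \<bar>ln r\<bar>" for r
  have ev: "\<forall>\<^sub>F r in at_right 0. 0 < g r \<and> c * g r \<le> f r \<and> f r \<le> C * g r"
    using eventually_at_right_0_ln[where P="\<lambda>r L. 0 < h L \<and> c * h L \<le> f r \<and> f r \<le> C * h L", OF bounds]
    by (simp add: g_def)
  have pos: "\<forall>\<^sub>F r in at_right 0. 0 < f r \<and> 0 < g r"
    using ev by eventually_elim (use assms(1) in \<open>auto intro: less_le_trans[OF mult_pos_pos]\<close>)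
  have "\<forall>\<^sub>F r in at_right 0. ereal (f r / g r) \<le> ereal C"
    using ev by eventually_elim (auto simp: field_simps)
  then have "Limsup (at_right 0) (\<lambda>r. ereal (f r / g r)) \<le> ereal C" by (rule Limsup_bounded)
  moreover have "\<forall>\<^sub>F r in at_right 0. ereal (g r / f r) \<le> ereal (1 / c)"
    using ev pos by eventually_elim (use assms(1) in \<open>auto simp: field_simps\<close>)
  then have "Limsup (at_right 0) (\<lambda>r. ereal (g r / f r)) \<le> ereal (1 / c)" by (rule Limsup_bounded)
  ultimately show ?thesis
    using pos unfolding g_def asymp_equiv_order_def asymp_le_def
    by (auto intro: le_less_trans simp: conj_commute)
qed

context smooth_spectral_gaussian
begin

text \<open>\<open>ball_prob_ge_exp\<close> in the variable L = - ln r. Positivity of the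
  probability is recorded as well, for use in the opposite bounds.\<close>

lemma small_ball_le:
  "\<forall>\<^sub>F L in at_top. \<forall>Q m :: nat. 0 < Q \<longrightarrow> 0 < m \<longrightarrow>
     (real Q + 1) * m * L \<le> exp L \<longrightarrow>
     (\<forall>k<m. moment k / (fact k * real Q ^ k)\<^sup>2 \<le> exp (2 * L)) \<longrightarrow>
     moment m / (fact m * real Q ^ m)\<^sup>2 \<le> exp (- 12 * L) \<longrightarrow>
     0 < ball_prob (exp (- L)) \<and> small_ball M X (exp (- L)) \<le> 6 * ((real Q + 1) * m * L)"
proof -
  have "filterlim (\<lambda>L::real. exp (- L)) (at_right 0) at_top" by real_asymp
  then have "\<forall>\<^sub>F L in at_top. \<forall>Q m :: nat. 0 < Q \<longrightarrow> 0 < m \<longrightarrow>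
     (real Q + 1) * m * - ln (exp (- L)) \<le> 1 / exp (- L) \<longrightarrow>
     (\<forall>k<m. moment k / (fact k * real Q ^ k)\<^sup>2 \<le> 1 / exp (- L) ^ 2) \<longrightarrow>
     moment m / (fact m * real Q ^ m)\<^sup>2 \<le> exp (- L) ^ 12 \<longrightarrow>
     exp (- (6 * ((real Q + 1) * m * - ln (exp (- L))))) \<le> ball_prob (exp (- L))"
    by (rule eventually_compose_filterlim[OF ball_prob_ge_exp])
  then show ?thesis
  proof eventually_elim
    case (elim L)
    have pow: "exp (- L) ^ k = exp (- (real k * L))" for k
      by (simp flip: exp_of_nat_mult)
    have e: "1 / exp (- L) = exp L" "1 / exp (- L) ^ 2 = exp (2 * L)" "exp (- L) ^ 12 = exp (- 12 * L)"
      unfolding pow by (simp_all add: exp_minus field_simps)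
    show ?case
    proof (intro allI impI)
      fix Q m :: nat
      assume "0 < Q" "0 < m" "(real Q + 1) * m * L \<le> exp L"
        "\<forall>k<m. moment k / (fact k * real Q ^ k)\<^sup>2 \<le> exp (2 * L)"
        "moment m / (fact m * real Q ^ m)\<^sup>2 \<le> exp (- 12 * L)"
      then have low: "exp (- (6 * ((real Q + 1) * m * L))) \<le> ball_prob (exp (- L))"
        using elim[unfolded e] by simp
      then have pos: "0 < ball_prob (exp (- L))" by (rule less_le_trans[OF exp_gt_zero])
      then have "- (6 * ((real Q + 1) * m * L)) \<le> ln (ball_prob (exp (- L)))"
        using low by (simp add: ln_ge_iff)
      with pos show "0 < ball_prob (exp (- L)) \<and> small_ball M X (exp (- L)) \<le> 6 * ((real Q + 1) * m * L)"
        by (simp add: small_ball_eq)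
    qed
  qed
qed

end

section \<open>Upper bounds on \<open>small_ball\<close> in the two regimes\<close>

context stretched_spectral_gaussian
begin

text \<open>\<open>Q\<close> is chosen so large that the base in \<open>moment_bound\<close> is at
  most exp (-1) for all k up to m. Lower moments are then at most \<open>C1\<close>, and the rank is
  of order m^b m = m^(1 / \<alpha>) with m proportional to L.\<close>

lemma small_ball_le_slow:
  assumes "\<alpha> \<le> 1"
  obtains C' where "0 < C'"
    "\<forall>\<^sub>F L in at_top. 0 < ball_prob (exp (- L)) \<and> small_ball M X (exp (- L)) \<le> C' * L powr (1 + 1 / \<alpha>)"
proof -
  obtain C1 C2 where C: "1 \<le> C1" "1 \<le> C2" "moment 0 \<le> C1"
    and mom: "\<And>k Q. 0 < k \<Longrightarrow> 0 < Q \<Longrightarrow>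
       moment k / (fact k * real Q ^ k)\<^sup>2 \<le> C1 * (C2 * real k powr (1 / \<alpha> - 1) / real Q) ^ (2 * k)"
    by (rule moment_bound) blast
  define b where "b = 1 / \<alpha> - 1"
  define a where "a = 1 / \<alpha>"
  have b: "0 \<le> b" using assms \<alpha>_pos by (simp add: b_def)
  have a: "0 < a" using \<alpha>_pos by (simp add: a_def)
  define C3 where "C3 = exp 1 * C2 + 2"
  have C3: "0 < C3" using C by (simp add: C3_def add_pos_pos)
  have ev1: "\<forall>\<^sub>F L in at_top. C3 * (8 * L) powr a * L \<le> exp L"
    using a C3 by real_asymp
  have ev2: "\<forall>\<^sub>F L in at_top. C1 \<le> exp (2 * L)" by real_asymp
  have ev3: "\<forall>\<^sub>F L in at_top. (1::real) \<le> L" by (rule eventually_ge_at_top)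
  have "\<forall>\<^sub>F L in at_top. 0 < ball_prob (exp (- L)) \<and>
      small_ball M X (exp (- L)) \<le> 6 * C3 * 8 powr a * L powr (1 + 1 / \<alpha>)"
    using small_ball_le ev1 ev2 ev3
  proof eventually_elim
    case (elim L)
    \<comment> \<open>The remainder is at most C1 exp (- 2 m); 7 L gives exp (- 14 L), of which exp
      (2 L) pays for \<open>C1\<close>.\<close>
    define m where "m = nat \<lceil>7 * L\<rceil>"
    define Q where "Q = nat \<lceil>exp 1 * C2 * real m powr b\<rceil>"
    have m: "7 * L \<le> m" "m \<le> 8 * L"
    proof -
      have "real m = of_int \<lceil>7 * L\<rceil>" using elim(4) by (simp add: m_def)
      then show "7 * L \<le> m" "m \<le> 8 * L" using elim(4) by linarith+
    qed
    then have m0: "0 < m" "1 \<le> real m" using elim(4) by linarith+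
    have mb: "1 \<le> real m powr b" using m0 b by (intro ge_one_powr_ge_zero) auto
    have e1: "1 \<le> exp (1::real)" by simp
    have eC: "1 \<le> exp 1 * C2 * real m powr b"
      using mult_mono[OF mult_mono[OF e1 C(2)] mb] C by simp
    then have Q: "exp 1 * C2 * real m powr b \<le> Q" "Q \<le> exp 1 * C2 * real m powr b + 1"
      by (auto simp: Q_def)
    then have Q0: "0 < Q" using eC by linarith
    have "real Q + 1 \<le> exp 1 * C2 * real m powr b + 2 * real m powr b" using Q(2) mb by linarith
    then have "real Q + 1 \<le> C3 * real m powr b" by (simp add: C3_def algebra_simps)
    then have "(real Q + 1) * m \<le> C3 * real m powr b * m" by (intro mult_right_mono) auto
    also have "\<dots> = C3 * real m powr a"
      using m0 powr_add[of "real m" b 1] by (simp add: a_def b_def)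
    also have "\<dots> \<le> C3 * (8 * L) powr a" using m C3 a by (intro mult_left_mono powr_mono2) auto
    finally have n: "(real Q + 1) * m * L \<le> C3 * (8 * L) powr a * L" using elim(4) by (intro mult_right_mono) auto
    have base: "C2 * real k powr b / real Q \<le> exp (- 1)" "0 \<le> C2 * real k powr b / real Q" if "0 < k" "k \<le> m" for k
    proof -
      have "exp 1 * (C2 * real k powr b) \<le> exp 1 * (C2 * real m powr b)"
        using that b C by (intro mult_left_mono powr_mono2) auto
      then have "exp 1 * (C2 * real k powr b) \<le> Q" using Q(1) unfolding mult.assoc by linarith
      then show "C2 * real k powr b / real Q \<le> exp (- 1)"
        using Q0 by (simp add: exp_minus field_simps)
      show "0 \<le> C2 * real k powr b / real Q" using C by simp
    qed
    have "moment k / (fact k * real Q ^ k)\<^sup>2 \<le> exp (2 * L)" if "k < m" for k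
    proof (cases "k = 0")
      case True
      then show ?thesis using C(3) elim(3) by simp
    next
      case False
      have "moment k / (fact k * real Q ^ k)\<^sup>2 \<le> C1 * (C2 * real k powr b / real Q) ^ (2 * k)"
        using False Q0 mom unfolding b_def by blast
      also have "\<dots> \<le> C1 * 1"
        using base[of k] False that C
        by (intro mult_left_mono power_le_one) (auto intro: order_trans[of _ "exp (- 1)"])
      finally show ?thesis using elim(3) by simp
    qed
    moreover have "moment m / (fact m * real Q ^ m)\<^sup>2 \<le> exp (- 12 * L)"
    proof -
      have "moment m / (fact m * real Q ^ m)\<^sup>2 \<le> C1 * (C2 * real m powr b / real Q) ^ (2 * m)"
        using m0 Q0 mom unfolding b_def by blast
      also have "\<dots> \<le> exp (2 * L) * exp (- 1) ^ (2 * m)"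
        using elim(3) base[of m] m0 C by (intro mult_mono power_mono) auto
      also have "\<dots> = exp (2 * L - 2 * real m)"
        unfolding exp_of_nat_mult[symmetric] exp_add[symmetric] by simp
      also have "\<dots> \<le> exp (- 12 * L)" using m by simp
      finally show ?thesis .
    qed
    moreover have "(real Q + 1) * m * L \<le> exp L" using n elim(2) by linarith
    ultimately have "0 < ball_prob (exp (- L)) \<and> small_ball M X (exp (- L)) \<le> 6 * ((real Q + 1) * m * L)"
      using elim(1) Q0 m0 by blast
    moreover have "6 * ((real Q + 1) * m * L) \<le> 6 * (C3 * (8 * L) powr a * L)" using n by linarith
    moreover have "6 * (C3 * (8 * L) powr a * L) = 6 * C3 * 8 powr a * L powr (1 + 1 / \<alpha>)"
      using elim(4) by (simp add: powr_mult powr_add a_def)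
    ultimately show ?case by linarith
  qed
  moreover have "0 < 6 * C3 * 8 powr a" using C3 by simp
  ultimately show thesis using that by blast
qed

text \<open>A single scale Q = 1 suffices, since the remainder is about exp (- 2 b m ln m) and hence
  small enough once m is a large multiple of L / ln L.\<close>

lemma small_ball_le_fast:
  assumes "1 < \<alpha>"
  obtains C' where "0 < C'"
    "\<forall>\<^sub>F L in at_top. 0 < ball_prob (exp (- L)) \<and> small_ball M X (exp (- L)) \<le> C' * (L ^ 2 / ln L)"
proof -
  obtain C1 C2 where C: "1 \<le> C1" "1 \<le> C2" "moment 0 \<le> C1"
    and mom: "\<And>k Q. 0 < k \<Longrightarrow> 0 < Q \<Longrightarrow>
       moment k / (fact k * real Q ^ k)\<^sup>2 \<le> C1 * (C2 * real k powr (1 / \<alpha> - 1) / real Q) ^ (2 * k)"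
    by (rule moment_bound) blast
  define b where "b = 1 - 1 / \<alpha>"
  \<comment> \<open>Eventually b ln m - c2 is at least (b / 4) ln L: half of ln L is lost to ln m
    and another part to \<open>c2\<close>. Thus 28 / b makes m times this at least 7 L, and doubling
    gives 14 L, of which 2 L pays for \<open>c1\<close>.\<close>
  define A where "A = 28 / b"
  define c1 where "c1 = ln C1"
  define c2 where "c2 = ln C2"
  have b: "0 < b" using assms by (simp add: b_def)
  then have A: "0 < A" by (simp add: A_def)
  have c: "0 \<le> c1" "0 \<le> c2" "C1 = exp c1" "C2 = exp c2" using C by (auto simp: c1_def c2_def)
  have ev1: "\<forall>\<^sub>F L in at_top. 4 * (A * (L / ln L)) * L \<le> exp L" using A by real_asymp
  have ev2: "\<forall>\<^sub>F L in at_top. c1 + 2 * (A * (L / ln L) + 1) * c2 \<le> 2 * L" using A by real_asymp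
  have ev3: "\<forall>\<^sub>F L in at_top. 1 \<le> A * (L / ln L)" using A by real_asymp
  have ev4: "\<forall>\<^sub>F L in at_top. 1 / 2 * ln L \<le> ln (A * (L / ln L))" using A by real_asymp
  have ev5: "\<forall>\<^sub>F L in at_top. c2 \<le> b / 4 * ln L" using b by real_asymp
  have ev6: "\<forall>\<^sub>F L in at_top. exp 1 < (L::real)" by (rule eventually_gt_at_top)
  have "\<forall>\<^sub>F L in at_top. 0 < ball_prob (exp (- L)) \<and>
      small_ball M X (exp (- L)) \<le> 24 * A * (L ^ 2 / ln L)"
    using small_ball_le ev1 ev2 ev3 ev4 ev5 ev6
  proof eventually_elim
    case (elim L)
    define S where "S = A * (L / ln L)"
    define m where "m = nat \<lceil>S\<rceil>"
    have L: "1 < L" using elim(7) exp_ge_add_one_self[of "1::real"] by linarith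
    then have lnL: "0 < ln L" by simp
    have m: "S \<le> m" "m \<le> S + 1" using elim(4) by (auto simp: m_def S_def)
    then have m0: "0 < m" "1 \<le> real m" using elim(4) unfolding S_def[symmetric] by linarith+
    have kb: "C2 * real k powr (1 / \<alpha> - 1) / real 1 = exp (c2 - b * ln k)" if "0 < k" for k
      using that by (simp add: c b_def powr_def exp_diff algebra_simps flip: exp_add)
    have mk: "moment k / (fact k * real 1 ^ k)\<^sup>2 \<le> exp (c1 + 2 * real k * (c2 - b * ln k))" if "0 < k" for k
    proof -
      have "moment k / (fact k * real 1 ^ k)\<^sup>2 \<le> C1 * (C2 * real k powr (1 / \<alpha> - 1) / real 1) ^ (2 * k)"
        using that by (intro mom) auto
      also have "\<dots> = exp (c1 + 2 * real k * (c2 - b * ln k))"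
        unfolding kb[OF that] c(3) by (simp add: exp_add flip: exp_of_nat_mult)
      finally show ?thesis .
    qed
    have "moment k / (fact k * real 1 ^ k)\<^sup>2 \<le> exp (2 * L)" if "k < m" for k
    proof (cases "k = 0")
      case True
      have "0 \<le> 2 * (A * (L / ln L) + 1) * c2" using elim(4) c by simp
      then have "c1 \<le> 2 * L" using elim(3) by linarith
      then show ?thesis using True C(3) c(3) by (auto intro: order_trans)
    next
      case False
      have "real k * (c2 - b * ln k) \<le> real k * c2"
        using False b by (intro mult_left_mono) auto
      also have "\<dots> \<le> (S + 1) * c2" using that m c by (intro mult_right_mono) auto
      finally have "real k * (c2 - b * ln k) \<le> (S + 1) * c2" .
      then have "c1 + 2 * real k * (c2 - b * ln k) \<le> c1 + 2 * (S + 1) * c2" by (simp add: algebra_simps)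
      then have "c1 + 2 * real k * (c2 - b * ln k) \<le> 2 * L" using elim(3) by (simp add: S_def)
      then have "exp (c1 + 2 * real k * (c2 - b * ln k)) \<le> exp (2 * L)" by simp
      with mk[of k] False show ?thesis by linarith
    qed
    moreover have "moment m / (fact m * real 1 ^ m)\<^sup>2 \<le> exp (- 12 * L)"
    proof -
      have "ln S \<le> ln m" using m(1) elim(4) by (intro ln_mono) (auto simp: S_def)
      then have "1 / 2 * ln L \<le> ln m" using elim(5) by (simp add: S_def)
      then have "b * (1 / 2 * ln L) \<le> b * ln m" using b by (intro mult_left_mono) auto
      then have "b / 4 * ln L \<le> b * ln m - c2" using elim(6) by linarith
      then have "S * (b / 4 * ln L) \<le> real m * (b * ln m - c2)"
        using m b lnL elim(4) by (intro mult_mono) (auto simp: S_def)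
      moreover have "S * (b / 4 * ln L) = 7 * L" using b lnL by (simp add: S_def A_def)
      moreover have "0 \<le> 2 * (A * (L / ln L) + 1) * c2" using elim(4) c by simp
      ultimately have "c1 + 2 * real m * (c2 - b * ln m) \<le> - 12 * L"
        using elim(3) by (simp add: algebra_simps)
      then have "exp (c1 + 2 * real m * (c2 - b * ln m)) \<le> exp (- 12 * L)" by simp
      with mk[OF m0(1)] show ?thesis by linarith
    qed
    moreover have n: "(real 1 + 1) * m * L \<le> 4 * S * L"
      using m(2) elim(4) L unfolding S_def[symmetric] by (intro mult_right_mono) auto
    then have "(real 1 + 1) * m * L \<le> exp L" using elim(2) unfolding S_def by linarith
    ultimately have "0 < ball_prob (exp (- L)) \<and> small_ball M X (exp (- L)) \<le> 6 * ((real 1 + 1) * m * L)"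
      using elim(1) m0 by (metis zero_less_one)
    moreover have "6 * (4 * S * L) = 24 * A * (L ^ 2 / ln L)" by (simp add: S_def power2_eq_square)
    ultimately show ?case using n by linarith
  qed
  moreover have "0 < 24 * A" using A by simp
  ultimately show thesis using that by blast
qed

end

section \<open>Lower bounds on \<open>small_ball\<close> in the two regimes\<close>

context spectral_gaussian
begin

text \<open>With n about L / (6 ln L) the coefficient loss n ln (4 n^2) is at most L / 2, so the
  bracket in \<open>small_ball_ge_flat\<close> keeps at least L / 4. As n is at least half of L / (6
  ln L), the constant is 1/48.\<close>

lemma small_ball_ge_fast:
  assumes "0 < c" "\<And>u. \<bar>u\<bar> \<le> 1 \<Longrightarrow> c \<le> f u"
  shows "\<forall>\<^sub>F L in at_top. 0 < ball_prob (exp (- L)) \<longrightarrow> 1 / 48 * (L ^ 2 / ln L) \<le> small_ball M X (exp (- L))"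
proof -
  have ev1: "\<forall>\<^sub>F L in at_top. 2 \<le> L / (6 * ln (L::real))" by real_asymp
  have ev2: "\<forall>\<^sub>F L in at_top. ln (4 * (L / (6 * ln L)) ^ 2) \<le> 3 * ln (L::real)" by real_asymp
  have ev3: "\<forall>\<^sub>F L in at_top. - L / 4 \<le> ln c / 2 - 1 / 2" by real_asymp
  have ev4: "\<forall>\<^sub>F L in at_top. exp 1 < (L::real)" by (rule eventually_gt_at_top)
  from ev1 ev2 ev3 ev4 show ?thesis
  proof eventually_elim
    case (elim L)
    define x where "x = L / (6 * ln L)"
    define n where "n = nat \<lfloor>x\<rfloor>"
    have L: "1 < L" using elim(4) exp_ge_add_one_self[of "1::real"] by linarith
    then have lnL: "0 < ln L" by simp
    have "real n = of_int \<lfloor>x\<rfloor>" using elim(1) by (simp add: n_def x_def)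
    then have n: "real n \<le> x" "x - 1 \<le> real n" by linarith+
    then have n2: "x / 2 \<le> real n" "0 < n" using elim(1) unfolding x_def[symmetric] by linarith+
    have "ln (4 * real n ^ 2) \<le> ln (4 * x ^ 2)"
      using n n2 by (intro ln_mono mult_left_mono power_mono) auto
    then have "ln (4 * real n ^ 2) \<le> 3 * ln L" using elim(2) by (simp add: x_def)
    then have "real n * ln (4 * real n ^ 2) \<le> x * (3 * ln L)"
      using n n2 lnL elim(1) unfolding x_def[symmetric]
      by (intro order_trans[OF mult_left_mono mult_right_mono]) auto
    also have "\<dots> = L / 2" using lnL by (simp add: x_def)
    finally have "L / 4 \<le> L + ln c / 2 - real n * ln (4 * real n ^ 2) - 1 / 2" using elim(3) by linarith
    then have "x / 2 * (L / 4) \<le> real n * (L + ln c / 2 - real n * ln (4 * real n ^ 2) - 1 / 2)"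
      using n2 L by (intro mult_mono) auto
    moreover have "x / 2 * (L / 4) = 1 / 48 * (L ^ 2 / ln L)" by (simp add: x_def power2_eq_square)
    ultimately show ?case
      using small_ball_ge_flat[OF assms n2(2), of "exp (- L)"] by auto
  qed
qed

text \<open>With n about L^(1 / \<alpha>) / pi the density exponent (pi n)^\<alpha> is at most L, so
  the bracket in \<open>small_ball_ge_stretched\<close> keeps at least L / 4 for L \<ge> 2.\<close>

lemma small_ball_ge_slow:
  assumes "0 < \<alpha>" "\<And>u. exp (- (\<bar>u\<bar> powr \<alpha>)) \<le> f u"
  shows "\<forall>\<^sub>F L in at_top. 0 < ball_prob (exp (- L)) \<longrightarrow>
     1 / (8 * pi) * L powr (1 + 1 / \<alpha>) \<le> small_ball M X (exp (- L))"
proof -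
  define a where "a = 1 / \<alpha>"
  have a: "0 < a" using assms by (simp add: a_def)
  have ev1: "\<forall>\<^sub>F L in at_top. 2 \<le> L powr a / pi" using a by real_asymp
  have ev2: "\<forall>\<^sub>F L in at_top. (2::real) \<le> L" by (rule eventually_ge_at_top)
  from ev1 ev2 show ?thesis
  proof eventually_elim
    case (elim L)
    define x where "x = L powr a / pi"
    define n where "n = nat \<lfloor>x\<rfloor>"
    have "real n = of_int \<lfloor>x\<rfloor>" using elim(1) by (simp add: n_def x_def)
    then have n: "real n \<le> x" "x - 1 \<le> real n" by linarith+
    then have n2: "x / 2 \<le> real n" "0 < n" using elim(1) unfolding x_def[symmetric] by linarith+
    have "(pi * n) powr \<alpha> \<le> (L powr a) powr \<alpha>"
      using n(1) assms(1) by (intro powr_mono2) (auto simp: x_def field_simps)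
    also have "\<dots> = L" using assms(1) elim(2) by (simp add: powr_powr a_def)
    finally have "L / 4 \<le> L - (pi * n) powr \<alpha> / 2 - 1 / 2" using elim(2) by linarith
    then have "x / 2 * (L / 4) \<le> real n * (L - (pi * n) powr \<alpha> / 2 - 1 / 2)"
      using n2 elim(2) by (intro mult_mono) auto
    moreover have "x / 2 * (L / 4) = 1 / (8 * pi) * L powr (1 + 1 / \<alpha>)"
      using elim(2) by (simp add: x_def powr_add a_def)
    ultimately show ?case
      using small_ball_ge_stretched[OF assms n2(2), of "exp (- L)"] by auto
  qed
qed

end

section \<open>Combination of the bounds for the given spectral family\<close>

theorem theorem1p1:
  fixes \<nu> :: ereal and M :: "'a measure" and X :: "real \<Rightarrow> 'a \<Rightarrow> real"
  assumes "0 < \<nu>"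
    and "gaussian_process M X"
    and "centered_process M X"
    and "stationary_process M X"
    and "continuous_paths M X"
    and "has_spectral_measure M X (spectral_family \<nu>)"
  shows "(1 < \<nu> \<longrightarrow>
            asymp_equiv_order (small_ball M X) (\<lambda>r. \<bar>ln r\<bar> ^ 2 / ln \<bar>ln r\<bar>)) \<and>
         (\<nu> \<le> 1 \<longrightarrow>
            asymp_equiv_order (small_ball M X) (\<lambda>r. \<bar>ln r\<bar> powr (1 + 1 / real_of_ereal \<nu>)))"
proof -
  define f :: "real \<Rightarrow> real" where
    "f u = (if \<nu> = \<infinity> then indicator {-1..1} u else exp (- (\<bar>u\<bar> powr real_of_ereal \<nu>)))" for u
  interpret prob_space M using assms(2) by (simp add: gaussian_process_def)
  interpret spectral_gaussian M X f
  proof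
    show "has_spectral_measure M X (density lborel (\<lambda>u. ennreal (f u)))"
      using assms(6) by (simp add: spectral_family_def f_def)
    show "f \<in> borel_measurable borel" unfolding f_def by measurable
  qed (use assms in \<open>auto simp: f_def\<close>)
  show ?thesis
  proof (intro conjI impI)
    assume \<nu>: "1 < \<nu>"
    \<comment> \<open>For infinite \<nu> the indicator lies below exp 1 times exp (- u^2), so it is
      treated as a density with \<alpha> = 2; any \<alpha> > 1 gives the same order.\<close>
    have "\<exists>C \<alpha>. stretched_spectral_gaussian M X f C \<alpha> \<and> 1 < \<alpha>"
    proof (cases "\<nu> = \<infinity>")
      case True
      have "f u \<le> exp 1 * exp (- (\<bar>u\<bar> powr 2))" for u
      proof (cases "\<bar>u\<bar> \<le> 1")
        case True
        then have "\<bar>u\<bar> powr 2 \<le> 1 powr 2" by (intro powr_mono2) auto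
        then have "1 \<le> exp 1 * exp (- (\<bar>u\<bar> powr 2))" by (simp flip: exp_add)
        then show ?thesis using \<open>\<nu> = \<infinity>\<close> by (simp add: f_def indicator_def)
      next
        case False
        then show ?thesis using \<open>\<nu> = \<infinity>\<close> by (auto simp: f_def indicator_def)
      qed
      then have "stretched_spectral_gaussian M X f (exp 1) 2" by unfold_locales auto
      then show ?thesis by (intro exI[of _ "exp 1"] exI[of _ 2]) auto
    next
      case False
      then have "1 < real_of_ereal \<nu>" using \<nu> by (cases \<nu>) auto
      moreover from this have "stretched_spectral_gaussian M X f 1 (real_of_ereal \<nu>)"
        using False by unfold_locales (auto simp: f_def)
      ultimately show ?thesis by blast
    qed
    then obtain C \<alpha> where "stretched_spectral_gaussian M X f C \<alpha>" and \<alpha>: "1 < \<alpha>" by blast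
    then interpret S: stretched_spectral_gaussian M X f C \<alpha> by simp
    obtain C' where C': "0 < C'" and
      upper: "\<forall>\<^sub>F L in at_top. 0 < ball_prob (exp (- L)) \<and> small_ball M X (exp (- L)) \<le> C' * (L ^ 2 / ln L)"
      using S.small_ball_le_fast[OF \<alpha>] by blast
    \<comment> \<open>One constant serves all \<nu> here, because |u|^\<nu> is at most 1 on
      [-1, 1].\<close>
    have "exp (- 1) \<le> f u" if "\<bar>u\<bar> \<le> 1" for u
    proof (cases "\<nu> = \<infinity>")
      case True
      then show ?thesis using that by (simp add: f_def indicator_def abs_le_iff)
    next
      case False
      have "\<bar>u\<bar> powr real_of_ereal \<nu> \<le> 1 powr real_of_ereal \<nu>"
        using that assms(1) by (intro powr_mono2) (auto simp: real_of_ereal_pos)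
      then show ?thesis using False by (simp add: f_def)
    qed
    then have lower: "\<forall>\<^sub>F L in at_top. 0 < ball_prob (exp (- L)) \<longrightarrow>
        1 / 48 * (L ^ 2 / ln L) \<le> small_ball M X (exp (- L))"
      by (intro small_ball_ge_fast[of "exp (- 1)"]) auto
    have "\<forall>\<^sub>F L in at_top. 0 < L ^ 2 / ln (L::real)" by real_asymp
    \<comment> \<open>The positivity contained in \<open>upper\<close> discharges the premise in
      \<open>lower\<close>.\<close>
    with upper lower have "\<forall>\<^sub>F L in at_top. 0 < L ^ 2 / ln L \<and> 1 / 48 * (L ^ 2 / ln L) \<le> small_ball M X (exp (- L)) \<and>
        small_ball M X (exp (- L)) \<le> C' * (L ^ 2 / ln L)"
      by eventually_elim auto
    then show "asymp_equiv_order (small_ball M X) (\<lambda>r. \<bar>ln r\<bar> ^ 2 / ln \<bar>ln r\<bar>)"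
      by (intro asymp_equiv_orderI[where h="\<lambda>L. L ^ 2 / ln L" and c="1 / 48", OF _ C']) auto
  next
    assume \<nu>: "\<nu> \<le> 1"
    define \<alpha> where "\<alpha> = real_of_ereal \<nu>"
    have fin: "\<nu> \<noteq> \<infinity>" and \<alpha>: "0 < \<alpha>" "\<alpha> \<le> 1" using \<nu> assms(1) by (cases \<nu>; simp add: \<alpha>_def)+
    interpret S: stretched_spectral_gaussian M X f 1 \<alpha>
      using fin \<alpha> by unfold_locales (auto simp: f_def \<alpha>_def)
    obtain C' where C': "0 < C'" and
      upper: "\<forall>\<^sub>F L in at_top. 0 < ball_prob (exp (- L)) \<and> small_ball M X (exp (- L)) \<le> C' * L powr (1 + 1 / \<alpha>)"
      using S.small_ball_le_slow[OF \<alpha>(2)] by blast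
    have lower: "\<forall>\<^sub>F L in at_top. 0 < ball_prob (exp (- L)) \<longrightarrow>
        1 / (8 * pi) * L powr (1 + 1 / \<alpha>) \<le> small_ball M X (exp (- L))"
      using fin \<alpha> by (intro small_ball_ge_slow) (auto simp: f_def \<alpha>_def)
    have "\<forall>\<^sub>F L in at_top. (0::real) < L" by (rule eventually_gt_at_top)
    with upper lower have "\<forall>\<^sub>F L in at_top. 0 < L powr (1 + 1 / \<alpha>) \<and>
        1 / (8 * pi) * L powr (1 + 1 / \<alpha>) \<le> small_ball M X (exp (- L)) \<and>
        small_ball M X (exp (- L)) \<le> C' * L powr (1 + 1 / \<alpha>)"
      by eventually_elim auto
    then show "asymp_equiv_order (small_ball M X) (\<lambda>r. \<bar>ln r\<bar> powr (1 + 1 / real_of_ereal \<nu>))"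
      unfolding \<alpha>_def[symmetric] by (intro asymp_equiv_orderI[where h="\<lambda>L. L powr (1 + 1 / \<alpha>)" and c="1 / (8 * pi)", OF _ C']) auto
  qed
qed

end
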